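(* Let $(W,S)$ be a finite Coxeter system. A word $Q$ in $S$ has the SIN-property if and only if $Q$ is equal, up to commutations, to $\mathbf{c}^k\,\mathbf{w}_\circ(\mathbf{c})$ for some Coxeter element $c$ (with reduced word $\mathbf{c}$) and some non-negative integer $k$.
   Context: A Coxeter element is the product of all elements of $S$ in some order; $\mathbf{c}$ is a reduced word for it. $w_\circ$ is the longest element of $W$; $\psi:S\to S$ is the involution $\psi(s)=w_\circ^{-1}sw_\circ$, extended letterwise to words. The $c$-sorting word $\mathbf{w}_\circ(\mathbf{c})$ is the lexicographically first (as a sequence of positions) subword of $\mathbf{c}\mathbf{c}\mathbf{c}\cdots$ which is a reduced expression for $w_\circ$; $\mathbf{c}^k\mathbf{w}_\circ(\mathbf{c})$ is the concatenation of $k$ copies of $\mathbf{c}$ and $\mathbf{w}_\circ(\mathbf{c})$. Two words coincide up to commutations if one is obtained from the other by a sequence of interchanges of consecutive commuting letters. A word has the intervening neighbors property if for every pair of distinct non-commuting generators $s,t\in S$, the occurrences of $s$ and $t$ alternate in the word (the subword consisting of the letters $s$ and $t$ has no two consecutive equal letters). The Demazure product $\delta$ of a word is defined recursively: $\delta$ of the empty word is the identity, and $\delta(Q s)=\delta(Q)s$ if $\ell(\delta(Q)s)>\ell(\delta(Q))$ and $\delta(Qs)=\delta(Q)$ otherwise. A word $Q=(q_1,\dots,q_r)$ has the SIN-property (strong intervening neighbors property) if the word $(q_1,\dots,q_r,\psi(q_1),\dots,\psi(q_r))$ has the intervening neighbors property and $\delta(Q)=w_\circ$.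
   Formalization: The equivalence is stated for irreducible (W,S), since it fails for reducible ones (for commuting generators s,t the word (s,s,t) has the SIN-property but is not of the form c^k w_0(c)); that words of this form have the SIN-property is proved for every finite Coxeter system. *)

theory Defs
  imports "HOL-Algebra.Generated_Groups"
begin

definition word_prod :: "('a, 'b) monoid_scheme \<Rightarrow> 'a list \<Rightarrow> 'a" where
  "word_prod G ws = foldr (mult G) ws \<one>\<^bsub>G\<^esub>"

text \<open>The value \<open>0\<close> of a Coxeter matrix stands for infinity, i.e. for the absence of a relation.\<close>

definition coxeter_matrix :: "'a set \<Rightarrow> ('a \<Rightarrow> 'a \<Rightarrow> nat) \<Rightarrow> bool" where
  "coxeter_matrix S m \<longleftrightarrow>
     (\<forall>s\<in>S. m s s = 1) \<and> (\<forall>s\<in>S. \<forall>t\<in>S. m s t = m t s \<and> (s \<noteq> t \<longrightarrow> m s t \<noteq> 1))"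

definition delete_relator :: "'a set \<Rightarrow> ('a \<Rightarrow> 'a \<Rightarrow> nat) \<Rightarrow> 'a list \<Rightarrow> 'a list \<Rightarrow> bool" where
  "delete_relator S m u v \<longleftrightarrow>
     (\<exists>xs\<in>lists S. \<exists>ys\<in>lists S. \<exists>s\<in>S. \<exists>t\<in>S.
        u = xs @ concat (replicate (m s t) [s, t]) @ ys \<and> v = xs @ ys)"

text \<open>
  The last conjunct says that the group has the presentation with generators \<open>S\<close> and relations
  \<open>(s t)^(m s t) = 1\<close>. Words without formal inverses suffice, because the relations
  \<open>s s = 1\<close> (the case \<open>s = t\<close>) are among them.
\<close>

definition coxeter_system :: "('a, 'b) monoid_scheme \<Rightarrow> 'a set \<Rightarrow> bool" where
  "coxeter_system G S \<longleftrightarrow>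
     group G \<and> S \<subseteq> carrier G \<and> generate G S = carrier G \<and>
     (\<exists>m. coxeter_matrix S m \<and>
        (\<forall>u\<in>lists S. \<forall>v\<in>lists S.
           word_prod G u = word_prod G v \<longleftrightarrow> equivclp (delete_relator S m) u v))"

definition commuting :: "('a, 'b) monoid_scheme \<Rightarrow> 'a \<Rightarrow> 'a \<Rightarrow> bool" where
  "commuting G s t \<longleftrightarrow> s \<otimes>\<^bsub>G\<^esub> t = t \<otimes>\<^bsub>G\<^esub> s"

text \<open>
  Connectedness of the Coxeter graph; the rank 0 system is allowed. Irreducibility is needed for
  the SIN-property to force the form \<open>c^k w\<^sub>0(c)\<close>: for two commuting generators \<open>s\<close>, \<open>t\<close>
  the word \<open>s s t\<close> has the SIN-property, but every \<open>c^k w\<^sub>0(c)\<close> contains \<open>s\<close> and \<open>t\<close>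
  equally often.
\<close>

definition irreducible_system :: "('a, 'b) monoid_scheme \<Rightarrow> 'a set \<Rightarrow> bool" where
  "irreducible_system G S \<longleftrightarrow>
     \<not> (\<exists>J K. J \<noteq> {} \<and> K \<noteq> {} \<and> J \<inter> K = {} \<and> J \<union> K = S \<and> (\<forall>s\<in>J. \<forall>t\<in>K. commuting G s t))"

definition cox_length :: "('a, 'b) monoid_scheme \<Rightarrow> 'a set \<Rightarrow> 'a \<Rightarrow> nat" where
  "cox_length G S w = (LEAST n. \<exists>ws\<in>lists S. length ws = n \<and> word_prod G ws = w)"

definition reduced_word :: "('a, 'b) monoid_scheme \<Rightarrow> 'a set \<Rightarrow> 'a list \<Rightarrow> 'a \<Rightarrow> bool" where
  "reduced_word G S ws w \<longleftrightarrow>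
     ws \<in> lists S \<and> word_prod G ws = w \<and> length ws = cox_length G S w"

definition longest_element :: "('a, 'b) monoid_scheme \<Rightarrow> 'a set \<Rightarrow> 'a" where
  "longest_element G S =
     (THE w. w \<in> carrier G \<and> (\<forall>v\<in>carrier G. cox_length G S v \<le> cox_length G S w))"

definition psi :: "('a, 'b) monoid_scheme \<Rightarrow> 'a set \<Rightarrow> 'a \<Rightarrow> 'a" where
  "psi G S s = inv\<^bsub>G\<^esub> (longest_element G S) \<otimes>\<^bsub>G\<^esub> s \<otimes>\<^bsub>G\<^esub> longest_element G S"

definition coxeter_element :: "('a, 'b) monoid_scheme \<Rightarrow> 'a set \<Rightarrow> 'a \<Rightarrow> bool" where
  "coxeter_element G S c \<longleftrightarrow> (\<exists>ws. distinct ws \<and> set ws = S \<and> word_prod G ws = c)"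

text \<open>The subword of the infinite word \<open>cs cs cs \<dots>\<close> at the positions \<open>ps\<close>, counted from \<open>0\<close>.\<close>

definition periodic_subword :: "'a list \<Rightarrow> nat list \<Rightarrow> 'a list" where
  "periodic_subword cs ps = map (\<lambda>p. cs ! (p mod length cs)) ps"

definition sorting_positions ::
    "('a, 'b) monoid_scheme \<Rightarrow> 'a set \<Rightarrow> 'a list \<Rightarrow> 'a \<Rightarrow> nat list set" where
  "sorting_positions G S cs w =
     {ps. sorted_wrt (<) ps \<and> reduced_word G S (periodic_subword cs ps) w}"

definition sorting_word :: "('a, 'b) monoid_scheme \<Rightarrow> 'a set \<Rightarrow> 'a list \<Rightarrow> 'a \<Rightarrow> 'a list" where
  "sorting_word G S cs w = periodic_subword cs
     (THE ps. ps \<in> sorting_positions G S cs w \<and>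
        (\<forall>qs\<in>sorting_positions G S cs w. qs \<noteq> ps \<longrightarrow> (ps, qs) \<in> lexord less_than))"

definition commutation_step :: "('a, 'b) monoid_scheme \<Rightarrow> 'a list \<Rightarrow> 'a list \<Rightarrow> bool" where
  "commutation_step G u v \<longleftrightarrow>
     (\<exists>xs ys s t. commuting G s t \<and> u = xs @ [s, t] @ ys \<and> v = xs @ [t, s] @ ys)"

definition equal_up_to_commutations ::
    "('a, 'b) monoid_scheme \<Rightarrow> 'a list \<Rightarrow> 'a list \<Rightarrow> bool" where
  "equal_up_to_commutations G = (commutation_step G)\<^sup>*\<^sup>*"

definition intervening_neighbors :: "('a, 'b) monoid_scheme \<Rightarrow> 'a set \<Rightarrow> 'a list \<Rightarrow> bool" where
  "intervening_neighbors G S Q \<longleftrightarrow>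
     (\<forall>s\<in>S. \<forall>t\<in>S. s \<noteq> t \<and> \<not> commuting G s t \<longrightarrow>
        distinct_adj (filter (\<lambda>x. x = s \<or> x = t) Q))"

definition demazure :: "('a, 'b) monoid_scheme \<Rightarrow> 'a set \<Rightarrow> 'a list \<Rightarrow> 'a" where
  "demazure G S Q =
     foldl (\<lambda>w s. if cox_length G S (w \<otimes>\<^bsub>G\<^esub> s) > cox_length G S w then w \<otimes>\<^bsub>G\<^esub> s else w) \<one>\<^bsub>G\<^esub> Q"

lemma demazure_Nil: "demazure G S [] = \<one>\<^bsub>G\<^esub>"
  by (simp add: demazure_def)

lemma demazure_snoc:
  "demazure G S (Q @ [s]) =
     (if cox_length G S (demazure G S Q \<otimes>\<^bsub>G\<^esub> s) > cox_length G S (demazure G S Q)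
      then demazure G S Q \<otimes>\<^bsub>G\<^esub> s else demazure G S Q)"
  by (simp add: demazure_def)

definition SIN_property :: "('a, 'b) monoid_scheme \<Rightarrow> 'a set \<Rightarrow> 'a list \<Rightarrow> bool" where
  "SIN_property G S Q \<longleftrightarrow>
     intervening_neighbors G S (Q @ map (psi G S) Q) \<and> demazure G S Q = longest_element G S"

end

theory Submission
  imports Defs Complex_Main "HOL-Library.Multiset"
begin

text \<open>
  Fix a word \<open>c\<close> listing \<open>S\<close> and orient the Coxeter graph by the order of the letters in \<open>c\<close>.
  Up to commutations, the prefixes of \<open>c c c \<dots>\<close> are the sequences of letters obtained by repeatedly
  firing a source, i.e. reversing all edges at a source.

  Among all factorizations \<open>B P\<close> of firing sequences with \<open>P\<close> reduced take one with \<open>P\<close> longest. Any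
  further letter \<open>t\<close> that may be fired is a descent of \<open>P\<close>, so it can be exchanged for a letter \<open>s\<close>
  of \<open>P\<close>. The key point is that \<open>s\<close> commutes with everything before it in \<open>P\<close>: otherwise the invariance
  of the Euler form of the orientation under firing contradicts the positivity of the roots of \<open>P\<close>.
  Hence \<open>s\<close> moves from \<open>P\<close> to \<open>B\<close>, the letter \<open>t\<close> is appended to \<open>P\<close>, and the element
  represented by \<open>P\<close> does not change. As every generator is fired eventually, all of them are descents of
  this element, which is therefore \<open>w\<^sub>0\<close>; moreover \<open>t = \<psi> s\<close>. Rotating on until \<open>B\<close> is a power
  of \<open>c\<close> gives a firing sequence \<open>P\<close> that is a reduced word for \<open>w\<^sub>0\<close> and such that \<open>P \<psi>(R)\<close> is a
  firing sequence for every firing sequence \<open>R\<close>. This \<open>P\<close> is the sorting word up to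
  commutations, because a letter skipped by it commutes with all later letters of \<open>P\<close>.

  Conversely, a word \<open>Q\<close> with the SIN-property is a firing sequence for the order \<open>c\<close> of first
  occurrences in \<open>Q\<close>. Since \<open>Q\<close> and \<open>P\<close> can both be continued by \<open>\<psi>(Q)\<close>, the numbers of
  occurrences of a letter in \<open>Q\<close> and in \<open>P\<close> differ by an amount that is the same for adjacent
  letters, hence by a constant \<open>k\<close> if the graph is connected.
\<close>

section \<open>Alternating words and the geometric representation\<close>

fun alternating :: "'a \<Rightarrow> 'a \<Rightarrow> nat \<Rightarrow> 'a list" where
  "alternating a b 0 = []"
| "alternating a b (Suc n) = a # alternating b a n"

lemma length_alternating [simp]: "length (alternating a b n) = n"
  by (induction n arbitrary: a b) auto

lemma alternating_add:
  "alternating a b (n + k) = alternating a b n @ (if even n then alternating a b k else alternating b a k)"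
  by (induction n arbitrary: a b) auto

lemma alternating_Suc_snoc:
  "alternating a b (Suc n) = alternating a b n @ [if even n then a else b]"
  using alternating_add[of a b n 1] by simp

lemma rev_alternating:
  "rev (alternating a b n) = (if even n then alternating b a n else alternating a b n)"
proof (induction n arbitrary: a b)
  case (Suc n)
  then show ?case
    using alternating_Suc_snoc[of a b n] alternating_Suc_snoc[of b a n] by auto
qed simp

lemma concat_replicate_pair: "concat (replicate n [s, t]) = alternating s t (2 * n)"
  by (induction n) auto

lemma set_alternating: "set (alternating a b n) \<subseteq> {a, b}"
  by (induction n arbitrary: a b) auto

text \<open>The Chebyshev values \<open>sin (k * \<theta>) / sin \<theta>\<close> at
  \<open>\<theta> = pi / m\<close>, which are the coordinates of roots in a dihedral group. Since
  \<open>m = 0\<close> encodes infinity, its value \<open>k\<close> is the limit for growing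
  \<open>m\<close>.\<close>

definition dihedral_coeff :: "nat \<Rightarrow> nat \<Rightarrow> real" where
  "dihedral_coeff m k = (if m = 0 then real k else sin (real k * (pi / real m)) / sin (pi / real m))"

text \<open>Twice the usual cosine form, so that the diagonal case \<open>m = 1\<close> gives 2; the
  value at \<open>m = 0\<close> is again the limit.\<close>

definition coxeter_entry :: "nat \<Rightarrow> real" where
  "coxeter_entry m = (if m = 0 then -2 else - 2 * cos (pi / real m))"

lemma coxeter_entry_1 [simp]: "coxeter_entry (Suc 0) = 2"
  by (simp add: coxeter_entry_def)

lemma sin_pi_div_pos: "2 \<le> m \<Longrightarrow> 0 < sin (pi / real m)"
  by (rule sin_gt_zero) (auto simp: field_simps)

lemma dihedral_coeff_0 [simp]: "dihedral_coeff m 0 = 0"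
  by (simp add: dihedral_coeff_def)

lemma dihedral_coeff_1 [simp]: "m \<noteq> 1 \<Longrightarrow> dihedral_coeff m (Suc 0) = 1"
  using sin_pi_div_pos[of m] by (cases "m = 0") (auto simp: dihedral_coeff_def)

text \<open>The sum of the sines of \<open>(k + 1) * \<theta> + \<theta>\<close> and
  \<open>(k + 1) * \<theta> - \<theta>\<close>. Each further reflection in an alternating word is
  one step of this recurrence.\<close>

lemma dihedral_coeff_Suc_Suc:
  "dihedral_coeff m (Suc (Suc k)) = - coxeter_entry m * dihedral_coeff m (Suc k) - dihedral_coeff m k"
proof (cases "m = 0")
  case False
  define \<theta> where "\<theta> = pi / real m"
  have "sin (real k * \<theta> + 2 * \<theta>) = 2 * cos \<theta> * sin (real k * \<theta> + \<theta>) - sin (real k * \<theta>)"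
  proof -
    have "sin ((real k * \<theta> + \<theta>) + \<theta>) + sin ((real k * \<theta> + \<theta>) - \<theta>)
        = 2 * cos \<theta> * sin (real k * \<theta> + \<theta>)"
      unfolding sin_add[of "real k * \<theta> + \<theta>"] sin_diff by simp
    then show ?thesis by (simp add: algebra_simps)
  qed
  moreover have "real (Suc (Suc k)) * \<theta> = real k * \<theta> + 2 * \<theta>" "real (Suc k) * \<theta> = real k * \<theta> + \<theta>"
    by (simp_all add: algebra_simps)
  ultimately show ?thesis using False
    unfolding dihedral_coeff_def coxeter_entry_def \<theta>_def[symmetric]
    by (simp add: diff_divide_distrib)
qed (simp add: dihedral_coeff_def coxeter_entry_def)

lemma dihedral_coeff_nonneg:
  assumes "m = 0 \<or> k \<le> m" "m \<noteq> 1"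
  shows "0 \<le> dihedral_coeff m k"
proof (cases "m = 0")
  case False
  then have "0 \<le> sin (real k * (pi / real m))"
    using assms by (intro sin_ge_zero) (auto simp: field_simps)
  then show ?thesis
    using False assms sin_pi_div_pos[of m] by (auto simp: dihedral_coeff_def)
qed (simp add: dihedral_coeff_def)

lemma coxeter_entry_2 [simp]: "coxeter_entry 2 = 0"
  by (simp add: coxeter_entry_def)

lemma coxeter_entry_neg: "m \<noteq> 1 \<Longrightarrow> m \<noteq> 2 \<Longrightarrow> coxeter_entry m < 0"
proof (cases "m = 0")
  case False
  assume "m \<noteq> 1" "m \<noteq> 2"
  then have "real m > 2" using False by linarith
  then have "pi / real m < pi / 2" by (simp add: field_simps)
  then have "cos (pi / real m) > 0" using False by (intro cos_gt_zero) auto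
  then show ?thesis using False by (simp add: coxeter_entry_def)
qed (simp add: coxeter_entry_def)

lemma coxeter_entry_nonpos: "m \<noteq> 1 \<Longrightarrow> coxeter_entry m \<le> 0"
  using coxeter_entry_neg[of m] by (cases "m = 2") auto

locale coxeter_presentation = group W for W (structure) +
  fixes S :: "'a set" and m :: "'a \<Rightarrow> 'a \<Rightarrow> nat"
  assumes S_carrier: "S \<subseteq> carrier W"
    and S_generates: "generate W S = carrier W"
    and matrix: "coxeter_matrix S m"
    and presentation: "\<And>u v. u \<in> lists S \<Longrightarrow> v \<in> lists S \<Longrightarrow>
      word_prod W u = word_prod W v \<longleftrightarrow> equivclp (delete_relator S m) u v"
    and finite_carrier: "finite (carrier W)"
begin

lemma finite_S: "finite S"
  using S_carrier finite_carrier finite_subset by blast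

abbreviation A :: "'a \<Rightarrow> 'a \<Rightarrow> real" where
  "A s t \<equiv> coxeter_entry (m s t)"

lemma A_same [simp]: "s \<in> S \<Longrightarrow> A s s = 2"
  using matrix by (simp add: coxeter_matrix_def)

lemma A_sym: "s \<in> S \<Longrightarrow> t \<in> S \<Longrightarrow> A s t = A t s"
  using matrix by (simp add: coxeter_matrix_def)

lemma m_neq_1: "s \<in> S \<Longrightarrow> t \<in> S \<Longrightarrow> s \<noteq> t \<Longrightarrow> m s t \<noteq> 1"
  using matrix by (simp add: coxeter_matrix_def)

text \<open>Vectors are given by their coordinates in the simple roots; coordinates outside
  \<open>S\<close> are ignored here and left alone by the reflections. \<open>pairing s\<close> is
  the functional of the simple coroot at \<open>s\<close>.\<close>

definition pairing :: "'a \<Rightarrow> ('a \<Rightarrow> real) \<Rightarrow> real" where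
  "pairing s x = (\<Sum>i\<in>S. A s i * x i)"

definition reflection :: "'a \<Rightarrow> ('a \<Rightarrow> real) \<Rightarrow> 'a \<Rightarrow> real" where
  "reflection s x = x(s := x s - pairing s x)"

definition simple_root :: "'a \<Rightarrow> 'a \<Rightarrow> real" where
  "simple_root s i = (if i = s then 1 else 0)"

definition word_action :: "'a list \<Rightarrow> ('a \<Rightarrow> real) \<Rightarrow> 'a \<Rightarrow> real" where
  "word_action Q x = foldr reflection Q x"

lemma word_action_Nil [simp]: "word_action [] x = x"
  and word_action_Cons [simp]: "word_action (s # Q) x = reflection s (word_action Q x)"
  and word_action_append [simp]: "word_action (P @ Q) x = word_action P (word_action Q x)"
  by (simp_all add: word_action_def)

lemma pairing_upd:
  assumes "t \<in> S"
  shows "pairing s (x(t := x t - d)) = pairing s x - A s t * d"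
proof -
  have "pairing s (x(t := x t - d)) = (\<Sum>i\<in>S. A s i * x i - (if i = t then A s t * d else 0))"
    unfolding pairing_def by (rule sum.cong) (auto simp: algebra_simps)
  then show ?thesis
    using assms finite_S by (simp add: sum_subtractf sum.delta pairing_def)
qed

lemma pairing_linear: "pairing s (\<lambda>i. a * x i + b * y i) = a * pairing s x + b * pairing s y"
  by (simp add: pairing_def sum.distrib sum_distrib_left algebra_simps)

lemma pairing_simple_root: "t \<in> S \<Longrightarrow> pairing s (simple_root t) = A s t"
  using finite_S by (simp add: pairing_def simple_root_def if_distrib sum.delta cong: if_cong)

lemma reflection_linear:
  "reflection s (\<lambda>i. a * x i + b * y i) = (\<lambda>i. a * reflection s x i + b * reflection s y i)"
  by (auto simp: reflection_def pairing_linear algebra_simps)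

lemma word_action_linear:
  "word_action Q (\<lambda>i. a * x i + b * y i) = (\<lambda>i. a * word_action Q x i + b * word_action Q y i)"
  by (induction Q) (simp_all add: reflection_linear)

lemma word_action_uminus: "word_action Q (\<lambda>i. - x i) = (\<lambda>i. - word_action Q x i)"
  using word_action_linear[of Q "-1" x 0 x] by simp

lemma reflection_uminus: "reflection s (\<lambda>i. - x i) = (\<lambda>i. - reflection s x i)"
  using word_action_uminus[of "[s]" x] by simp

lemma reflection_other [simp]: "i \<noteq> s \<Longrightarrow> reflection s x i = x i"
  by (simp add: reflection_def)

lemma reflection_reflection [simp]: "s \<in> S \<Longrightarrow> reflection s (reflection s x) = x"
  unfolding reflection_def by (simp add: pairing_upd)

lemma reflection_simple_root:
  "s \<in> S \<Longrightarrow> t \<in> S \<Longrightarrow>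
    reflection s (simple_root t) = (\<lambda>i. 1 * simple_root t i + (- A s t) * simple_root s i)"
  by (auto simp: reflection_def pairing_simple_root simple_root_def)

lemma reflection_simple_root_same:
  "s \<in> S \<Longrightarrow> reflection s (simple_root s) = (\<lambda>i. - simple_root s i)"
  by (simp add: reflection_simple_root)

lemma word_action_notin: "i \<notin> set Q \<Longrightarrow> word_action Q x i = x i"
  by (induction Q) auto

lemma word_action_rev_cancel: "Q \<in> lists S \<Longrightarrow> word_action Q (word_action (rev Q) x) = x"
  by (induction Q arbitrary: x) auto

lemma word_action_rev_cancel': "Q \<in> lists S \<Longrightarrow> word_action (rev Q) (word_action Q x) = x"
  using word_action_rev_cancel[of "rev Q" x] by (simp add: in_lists_conv_set)

text \<open>On the plane of the two simple roots \<open>s t\<close> is a rotation by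
  \<open>2 * \<theta>\<close>, and on any \<open>x\<close> it subtracts a vector of this plane
  depending only on the two pairings of \<open>x\<close>. The closed form serves to see that the
  relator \<open>(s t)^(m s t)\<close> acts trivially, because the angle then reaches
  \<open>2 * pi\<close>.\<close>

lemma dihedral_iterate:
  assumes st: "s \<in> S" "t \<in> S" "s \<noteq> t" and A: "A s t = - 2 * cos \<theta>" and nz: "sin \<theta> \<noteq> 0"
  shows "word_action (concat (replicate n [s, t])) x =
    x(t := x t - (pairing s x * (cos \<theta> - cos (2 * n * \<theta> - \<theta>))
                  + pairing t x * (1 - cos (2 * n * \<theta>))) / (2 * (sin \<theta>)\<^sup>2),
      s := x s - (pairing s x * (1 - cos (2 * n * \<theta>))
                  + pairing t x * (cos \<theta> - cos (2 * n * \<theta> + \<theta>))) / (2 * (sin \<theta>)\<^sup>2))"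
    (is "_ = x(t := x t - ?T n, s := x s - ?U n)")
proof (induction n)
  case 0
  show ?case using st by auto
next
  case (Suc n)
  let ?y = "x(t := x t - ?T n, s := x s - ?U n)"
  \<comment> \<open>With names for the trigonometric values at \<open>\<theta>\<close> and at
    \<open>2 * n * \<theta>\<close>, all claims become rational identities in \<open>c\<close>,
    \<open>\<sigma>\<close>, \<open>C\<close>, \<open>Z\<close> modulo the relation between
    \<open>c\<close> and \<open>\<sigma>\<close>.\<close>
  define p q where "p = pairing s x" and "q = pairing t x"
  define c \<sigma> C Z where "c = cos \<theta>" and "\<sigma> = sin \<theta>" and "C = cos (2 * n * \<theta>)" and "Z = sin (2 * n * \<theta>)"
  have cs: "\<sigma>\<^sup>2 = 1 - c\<^sup>2" by (simp add: c_def \<sigma>_def sin_squared_eq)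
  have \<sigma>0: "\<sigma> \<noteq> 0" using nz by (simp add: \<sigma>_def)
  have angle: "2 * real (Suc n) * \<theta> - \<theta> = 2 * real n * \<theta> + \<theta>"
     "2 * real (Suc n) * \<theta> = (2 * real n * \<theta> + \<theta>) + \<theta>"
     "2 * real (Suc n) * \<theta> + \<theta> = ((2 * real n * \<theta> + \<theta>) + \<theta>) + \<theta>"
    by (simp_all add: algebra_simps)
  have cosn: "cos (2 * real n * \<theta> - \<theta>) = C * c + Z * \<sigma>" "cos (2 * real n * \<theta> + \<theta>) = C * c - Z * \<sigma>"
    "sin (2 * real n * \<theta> + \<theta>) = Z * c + C * \<sigma>"
    by (simp_all add: cos_diff cos_add sin_add C_def Z_def c_def \<sigma>_def)
  have cosn2: "cos (2 * real n * \<theta> + \<theta> + \<theta>) = (C * c - Z * \<sigma>) * c - (Z * c + C * \<sigma>) * \<sigma>"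
    "sin (2 * real n * \<theta> + \<theta> + \<theta>) = (Z * c + C * \<sigma>) * c + (C * c - Z * \<sigma>) * \<sigma>"
    unfolding cos_add[of "2 * real n * \<theta> + \<theta>"] sin_add[of "2 * real n * \<theta> + \<theta>"] cosn
    by (simp_all add: c_def \<sigma>_def)
  have cosn3: "cos (2 * real n * \<theta> + \<theta> + \<theta> + \<theta>) =
      ((C * c - Z * \<sigma>) * c - (Z * c + C * \<sigma>) * \<sigma>) * c - ((Z * c + C * \<sigma>) * c + (C * c - Z * \<sigma>) * \<sigma>) * \<sigma>"
    unfolding cos_add[of "2 * real n * \<theta> + \<theta> + \<theta>"] cosn2
    by (simp add: c_def \<sigma>_def)
  have cosS: "cos (2 * real (Suc n) * \<theta> - \<theta>) = C * c - Z * \<sigma>"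
    "cos (2 * real (Suc n) * \<theta>) = (C * c - Z * \<sigma>) * c - (Z * c + C * \<sigma>) * \<sigma>"
    "cos (2 * real (Suc n) * \<theta> + \<theta>) =
      ((C * c - Z * \<sigma>) * c - (Z * c + C * \<sigma>) * \<sigma>) * c - ((Z * c + C * \<sigma>) * c + (C * c - Z * \<sigma>) * \<sigma>) * \<sigma>"
    by (simp only: angle(1) cosn, simp only: angle(2) cosn2, simp only: angle(3) cosn3)
  have T: "?T n = (p * (c - (C * c + Z * \<sigma>)) + q * (1 - C)) / (2 * \<sigma>\<^sup>2)"
    and U: "?U n = (p * (1 - C) + q * (c - (C * c - Z * \<sigma>))) / (2 * \<sigma>\<^sup>2)"
    unfolding cosn by (simp_all add: p_def q_def c_def C_def \<sigma>_def)
  have T': "?T (Suc n) = (p * (c - (C * c - Z * \<sigma>)) + q * (1 - ((C * c - Z * \<sigma>) * c - (Z * c + C * \<sigma>) * \<sigma>))) / (2 * \<sigma>\<^sup>2)"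
    unfolding cosS by (simp add: p_def q_def c_def \<sigma>_def)
  have U': "?U (Suc n) = (p * (1 - ((C * c - Z * \<sigma>) * c - (Z * c + C * \<sigma>) * \<sigma>)) + q * (c - (
      ((C * c - Z * \<sigma>) * c - (Z * c + C * \<sigma>) * \<sigma>) * c - ((Z * c + C * \<sigma>) * c + (C * c - Z * \<sigma>) * \<sigma>) * \<sigma>))) / (2 * \<sigma>\<^sup>2)"
    unfolding cosS by (simp add: p_def q_def c_def \<sigma>_def)
  have A': "A t s = - 2 * c" "A s t = - 2 * c" using A A_sym st by (simp_all add: c_def)
  have pair: "pairing r ?y = pairing r x - A r t * ?T n - A r s * ?U n" for r
  proof -
    let ?x1 = "x(t := x t - ?T n)"
    have "?y = ?x1(s := ?x1 s - ?U n)" using st by simp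
    then have "pairing r ?y = pairing r ?x1 - A r s * ?U n" using pairing_upd[OF st(1), of r ?x1] by metis
    then show ?thesis using pairing_upd[OF st(2)] by simp
  qed
  define y where "y = ?y"
  \<comment> \<open>\<open>e\<close> and \<open>g\<close> are the amounts subtracted by the
    reflection in \<open>t\<close> and the following one in \<open>s\<close>.\<close>
  define e where "e = pairing t y"
  have e: "e = q - 2 * ?T n + 2 * c * ?U n"
    unfolding e_def y_def pair A' using st by (simp add: q_def)
  define g where "g = pairing s y + 2 * c * e"
  have g: "g = p + 2 * c * ?T n - 2 * ?U n + 2 * c * e"
    unfolding g_def y_def pair A' using st by (simp add: p_def)
  have r1: "reflection t y = y(t := y t - e)" by (simp add: reflection_def e_def)
  have "pairing s (y(t := y t - e)) = g"
    unfolding g_def pairing_upd[OF st(2)] A' by simp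
  then have r2: "reflection s (reflection t y) = y(t := y t - e, s := y s - g)"
    unfolding r1 reflection_def[of s] using st by simp
  have "e * \<sigma>\<^sup>2 = \<sigma> * (p * Z + q * (Z * c + C * \<sigma>))"
    unfolding e T U using \<sigma>0 cs by (simp add: field_simps) algebra
  then have "\<sigma> * (e * \<sigma>) = \<sigma> * (p * Z + q * (Z * c + C * \<sigma>))"
    by (simp only: power2_eq_square mult_ac)
  then have e1: "e = (p * Z + q * (Z * c + C * \<sigma>)) / \<sigma>"
    using \<sigma>0 by (simp only: mult_left_cancel eq_divide_eq) simp
  have "g * \<sigma>\<^sup>2 = \<sigma> * (p * (Z * c + C * \<sigma>) + q * ((Z * c + C * \<sigma>) * c + (C * c - Z * \<sigma>) * \<sigma>))"
    unfolding g T U e1 using \<sigma>0 cs by (simp add: field_simps) algebra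
  then have "\<sigma> * (g * \<sigma>) = \<sigma> * (p * (Z * c + C * \<sigma>) + q * ((Z * c + C * \<sigma>) * c + (C * c - Z * \<sigma>) * \<sigma>))"
    by (simp only: power2_eq_square mult_ac)
  then have g1: "g = (p * (Z * c + C * \<sigma>) + q * ((Z * c + C * \<sigma>) * c + (C * c - Z * \<sigma>) * \<sigma>)) / \<sigma>"
    using \<sigma>0 by (simp only: mult_left_cancel eq_divide_eq) simp
  have "?T n + e = ?T (Suc n)" unfolding T T' e1 using \<sigma>0 cs by (simp add: field_simps) algebra
  moreover have "?U n + g = ?U (Suc n)" unfolding U U' g1 using \<sigma>0 cs by (simp add: field_simps) algebra
  moreover have "y t = x t - ?T n" "y s = x s - ?U n" "\<And>i. i \<noteq> s \<Longrightarrow> i \<noteq> t \<Longrightarrow> y i = x i"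
    using st by (simp_all add: y_def)
  ultimately have "y(t := y t - e, s := y s - g) = x(t := x t - ?T (Suc n), s := x s - ?U (Suc n))"
    using st by (intro ext) (simp add: algebra_simps)
  moreover have "word_action (concat (replicate n [s, t])) x = y" unfolding y_def by (rule Suc)
  moreover have "word_action (concat (replicate (Suc n) [s, t])) x =
      reflection s (reflection t (word_action (concat (replicate n [s, t])) x))"
    by simp
  ultimately show ?case using r2 by (simp only:)
qed

end

section \<open>Length and positivity of roots\<close>

context coxeter_presentation begin

abbreviation wp :: "'a list \<Rightarrow> 'a" where "wp \<equiv> word_prod W"

abbreviation len :: "'a list \<Rightarrow> nat" where "len u \<equiv> cox_length W S (wp u)"

lemma wp_Nil [simp]: "wp [] = \<one>"
  and wp_Cons [simp]: "wp (s # u) = s \<otimes> wp u"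
  by (simp_all add: word_prod_def)

lemma wp_closed [simp]: "u \<in> lists S \<Longrightarrow> wp u \<in> carrier W"
  using S_carrier by (induction u) auto

lemma gen_carrier [simp]: "s \<in> S \<Longrightarrow> s \<in> carrier W"
  using S_carrier by auto

lemma wp_append: "u \<in> lists S \<Longrightarrow> v \<in> lists S \<Longrightarrow> wp (u @ v) = wp u \<otimes> wp v"
  by (induction u) (auto simp: m_assoc)

lemma wp_append_cong:
  "\<lbrakk>u \<in> lists S; v \<in> lists S; u' \<in> lists S; v' \<in> lists S; wp u = wp u'; wp v = wp v'\<rbrakk> \<Longrightarrow>
    wp (u @ v) = wp (u' @ v')"
  by (simp add: wp_append)

lemma wp_relator:
  assumes "s \<in> S" "t \<in> S"
  shows "wp (concat (replicate (m s t) [s, t])) = \<one>"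
proof -
  have "delete_relator S m (concat (replicate (m s t) [s, t])) []"
    unfolding delete_relator_def using assms by (intro bexI[of _ "[]"] bexI[of _ s] bexI[of _ t]) auto
  then have "equivclp (delete_relator S m) (concat (replicate (m s t) [s, t])) []"
    by (simp add: r_into_equivclp)
  moreover have "concat (replicate (m s t) [s, t]) \<in> lists S"
    using assms by (auto simp: in_lists_conv_set)
  ultimately show ?thesis using presentation[of _ "[]"] by auto
qed

lemma gen_square [simp]: "s \<in> S \<Longrightarrow> s \<otimes> s = \<one>"
  using wp_relator[of s s] matrix by (simp add: coxeter_matrix_def)

lemma gen_square_left [simp]: "s \<in> S \<Longrightarrow> g \<in> carrier W \<Longrightarrow> s \<otimes> (s \<otimes> g) = g"
  using m_assoc[of s s g] by simp

lemma inv_gen: "s \<in> S \<Longrightarrow> inv s = s"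
  using inv_equality[of s s] by simp

lemma wp_rev_cancel: "u \<in> lists S \<Longrightarrow> wp (rev u @ u) = \<one>"
proof (induction u)
  case (Cons s u)
  then have "rev u \<in> lists S" "u \<in> lists S" "s \<in> S" by (auto simp: in_lists_conv_set)
  then show ?case using Cons by (simp add: wp_append)
qed simp

lemma wp_rev: "u \<in> lists S \<Longrightarrow> wp (rev u) = inv (wp u)"
  using wp_rev_cancel[of u] by (subst eq_commute, intro inv_equality) (auto simp: wp_append in_lists_conv_set)

lemma rev_in_lists [simp]: "rev u \<in> lists S \<longleftrightarrow> u \<in> lists S"
  by (auto simp: in_lists_conv_set)

lemma wp_surj:
  assumes "g \<in> carrier W"
  obtains u where "u \<in> lists S" "wp u = g"
proof -
  have "g \<in> generate W S" using assms S_generates by simp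
  then have "\<exists>u\<in>lists S. wp u = g"
  proof induction
    case one
    show ?case by (rule bexI[of _ "[]"]) auto
  next
    case (incl h)
    then show ?case by (intro bexI[of _ "[h]"]) auto
  next
    case (inv h)
    then show ?case by (intro bexI[of _ "[h]"]) (auto simp: inv_gen)
  next
    case (eng h1 h2)
    then show ?case by (metis append_in_lists_conv wp_append)
  qed
  then show ?thesis using that by blast
qed

lemma word_action_relator:
  assumes "s \<in> S" "t \<in> S"
  shows "word_action (concat (replicate (m s t) [s, t])) x = x"
proof (cases "s = t")
  case True
  then show ?thesis using assms matrix by (simp add: coxeter_matrix_def)
next
  case False
  show ?thesis
  proof (cases "m s t = 0")
    case m0: False
    define \<theta> where "\<theta> = pi / real (m s t)"
    have m2: "m s t \<ge> 2" using m0 m_neq_1[OF assms False] by linarith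
    have A: "A s t = - 2 * cos \<theta>" using m0 by (simp add: coxeter_entry_def \<theta>_def)
    have nz: "sin \<theta> \<noteq> 0" using sin_pi_div_pos[OF m2] by (simp add: \<theta>_def)
    have ang: "2 * real (m s t) * \<theta> = 2 * pi" using m0 by (simp add: \<theta>_def)
    show ?thesis
      unfolding dihedral_iterate[OF assms False A nz] ang
      by (simp add: cos_add cos_diff)
  qed simp
qed

lemma word_action_delete_relator:
  assumes "delete_relator S m u v" shows "word_action u = word_action v"
  using assms unfolding delete_relator_def by (auto simp: word_action_relator)

lemma word_action_cong:
  assumes "u \<in> lists S" "v \<in> lists S" "wp u = wp v"
  shows "word_action u = word_action v"
proof -
  have "equivclp (delete_relator S m) u v" using assms presentation by blast
  then show ?thesis
    by (induction rule: equivclp_induct) (auto dest: word_action_delete_relator)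
qed

lemma length_relator_even: "delete_relator S m u v \<Longrightarrow> even (length u) = even (length v)"
  unfolding delete_relator_def by (auto simp: concat_replicate_pair)

text \<open>Relators have even length, so this is the sign character. It excludes that a letter
  leaves the length of an element unchanged.\<close>

lemma length_parity:
  assumes "u \<in> lists S" "v \<in> lists S" "wp u = wp v"
  shows "even (length u) = even (length v)"
proof -
  have "equivclp (delete_relator S m) u v" using assms presentation by blast
  then show ?thesis
    by (induction rule: equivclp_induct) (auto dest: length_relator_even)
qed

lemma len_le_length: "u \<in> lists S \<Longrightarrow> len u \<le> length u"
  unfolding cox_length_def by (rule Least_le) blast

lemma shortest_word:
  assumes "u \<in> lists S"
  obtains v where "v \<in> lists S" "wp v = wp u" "length v = len u"
proof -
  have "\<exists>v\<in>lists S. length v = len u \<and> wp v = wp u"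
    unfolding cox_length_def
    using LeastI[of "\<lambda>n. \<exists>v\<in>lists S. length v = n \<and> wp v = wp u" "length u"] assms by blast
  then show ?thesis using that by blast
qed

definition red :: "'a list \<Rightarrow> bool" where
  "red u \<longleftrightarrow> u \<in> lists S \<and> length u = len u"

lemma red_lists: "red u \<Longrightarrow> u \<in> lists S" by (simp add: red_def)

lemma red_exists:
  assumes "u \<in> lists S" obtains v where "red v" "wp v = wp u"
  using shortest_word[OF assms] that by (metis red_def)

lemma reduced_word_iff: "reduced_word W S u w \<longleftrightarrow> red u \<and> wp u = w"
  by (auto simp: reduced_word_def red_def)

lemma red_le: "red u \<Longrightarrow> v \<in> lists S \<Longrightarrow> wp v = wp u \<Longrightarrow> length u \<le> length v"
  using len_le_length[of v] by (simp add: red_def)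

text \<open>Replacing a factor by a shorter word for the same element would shorten the whole
  word.\<close>

lemma red_append:
  assumes "red (u @ v)" shows "red u" "red v"
proof -
  have l: "u \<in> lists S" "v \<in> lists S" using assms by (auto simp: red_def)
  obtain u' v' where uv: "red u'" "wp u' = wp u" "red v'" "wp v' = wp v"
    using red_exists l by metis
  then have l': "u' \<in> lists S" "v' \<in> lists S" by (auto simp: red_def)
  have "length (u @ v) \<le> length (u' @ v)" "length (u @ v) \<le> length (u @ v')"
    using uv l l' wp_append_cong[of u' v u v] wp_append_cong[of u v' u v] red_le[OF assms]
    by (simp_all del: length_append)
  then show "red u" "red v" using uv l len_le_length[of u] len_le_length[of v]
    by (auto simp: red_def)
qed

lemma len_snoc_le:
  assumes "u \<in> lists S" "s \<in> S"
  shows "len (u @ [s]) \<le> len u + 1" "len u \<le> len (u @ [s]) + 1" "len (u @ [s]) \<noteq> len u"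
proof -
  obtain v where v: "v \<in> lists S" "wp v = wp u" "length v = len u" using shortest_word assms by metis
  obtain v' where v': "v' \<in> lists S" "wp v' = wp (u @ [s])" "length v' = len (u @ [s])"
    using shortest_word[of "u @ [s]"] assms by auto
  have e: "wp (v @ [s]) = wp (u @ [s])" using v assms by (intro wp_append_cong) auto
  then show "len (u @ [s]) \<le> len u + 1" using len_le_length[of "v @ [s]"] v assms by simp
  have "wp (v' @ [s]) = wp u" using v' assms by (simp add: wp_append m_assoc)
  then show "len u \<le> len (u @ [s]) + 1" using len_le_length[of "v' @ [s]"] v' assms by simp
  have "even (length v') = even (length (v @ [s]))" using e v v' assms by (intro length_parity) auto
  then show "len (u @ [s]) \<noteq> len u" using v v' by auto
qed

text \<open>Half of the relator \<open>(s t)^(m s t)\<close> is moved to the other side. Reversals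
  fix the last letter of an alternating word, which is what matters when suffixes are split
  off.\<close>

lemma wp_braid:
  assumes "s \<in> S" "t \<in> S"
  shows "wp (rev (alternating t s (m s t))) = wp (rev (alternating s t (m s t)))"
proof -
  let ?n = "m s t"
  define Z where "Z = (if even ?n then alternating s t ?n else alternating t s ?n)"
  have Z: "Z = rev (alternating t s ?n)" by (simp add: Z_def rev_alternating)
  have l: "Z \<in> lists S" "alternating s t ?n \<in> lists S" 
    unfolding Z_def using assms set_alternating[of s t ?n] set_alternating[of t s ?n]
    by (auto simp: in_lists_conv_set)
  have "wp (alternating s t ?n @ Z) = \<one>"
    using wp_relator[OF assms] alternating_add[of s t ?n ?n]
    unfolding concat_replicate_pair Z_def mult_2 by simp
  then have "wp (alternating s t ?n) \<otimes> wp Z = \<one>" using l by (simp add: wp_append)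
  then have "inv (wp (alternating s t ?n)) = wp Z"
    using l by (metis inv_equality inv_inv wp_closed inv_closed)
  then show ?thesis using l Z by (simp add: wp_rev)
qed

definition nonneg :: "('a \<Rightarrow> real) \<Rightarrow> bool" where
  "nonneg x \<longleftrightarrow> (\<forall>i. 0 \<le> x i)"

lemma nonneg_simple_root [simp]: "nonneg (simple_root s)"
  by (simp add: nonneg_def simple_root_def)

text \<open>Prepending a letter reflects the combination of the two simple roots, and the new
  coefficient is given by \<open>dihedral_coeff_Suc_Suc\<close>. The coefficients are nonnegative up
  to the length of the braid relation.\<close>

lemma word_action_alternating:
  assumes "s \<in> S" "t \<in> S" "s \<noteq> t"
  shows "word_action (rev (alternating t s k)) (simple_root s) =
    (\<lambda>i. dihedral_coeff (m s t) (Suc k) * simple_root (if even k then s else t) i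
       + dihedral_coeff (m s t) k * simple_root (if even k then t else s) i)"
proof (induction k)
  case 0
  then show ?case using m_neq_1[OF assms] by simp
next
  case (Suc k)
  have *: "rev (alternating t s (Suc k)) = (if even k then t else s) # rev (alternating t s k)"
    by (subst alternating_Suc_snoc) simp
  have "m t s = m s t" using matrix assms by (simp add: coxeter_matrix_def)
  then show ?case
    unfolding * word_action_Cons Suc reflection_linear using assms
    by (intro ext) (simp add: reflection_simple_root dihedral_coeff_Suc_Suc algebra_simps)
qed

lemma alternating_in_lists: "s \<in> S \<Longrightarrow> t \<in> S \<Longrightarrow> alternating s t k \<in> lists S"
  using set_alternating[of s t k] by (auto simp: in_lists_conv_set)

text \<open>
  As in Humphreys, 5.4, but splitting off a maximal suffix alternating between two generators
  instead of a coset representative of a dihedral subgroup.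
\<close>

lemma root_nonneg:
  assumes "red u" "s \<in> S" "len (u @ [s]) > len u"
  shows "nonneg (word_action u (simple_root s))"
  using assms
proof (induction "length u" arbitrary: u s rule: less_induct)
  case less
  show ?case
  proof (cases u rule: rev_cases)
    case Nil
    then show ?thesis by simp
  next
    case (snoc u' t)
    have uS: "u \<in> lists S" "u' \<in> lists S" "t \<in> S" using less.prems snoc by (auto simp: red_def)
    note sS = \<open>s \<in> S\<close>
    have "s \<noteq> t"
    proof
      assume "s = t"
      then have "wp (u @ [s]) = wp u'" using snoc uS by (simp add: wp_append m_assoc)
      then have "len (u @ [s]) \<le> length u'" using len_le_length uS by metis
      then show False using less.prems snoc by (simp add: red_def)
    qed
    define alt where "alt k = rev (alternating t s k)" for k
    have altS [simp]: "alt k \<in> lists S" for k using alternating_in_lists uS sS by (simp add: alt_def)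
    \<comment> \<open>\<open>P k\<close>: without getting longer, \<open>u\<close> can be rewritten
      to end in the alternating word of length \<open>k\<close> in \<open>s\<close>,
      \<open>t\<close> with last letter \<open>t\<close>. A maximal such \<open>k\<close> is
      taken.\<close>
    define P where "P k \<longleftrightarrow> (\<exists>v\<in>lists S. wp u = wp (v @ alt k) \<and> length v + k = length u)" for k
    have "P 1" unfolding P_def using snoc uS by (intro bexI[of _ u']) (auto simp: alt_def)
    moreover have "\<And>k. P k \<Longrightarrow> k \<le> length u" by (auto simp: P_def)
    ultimately obtain k where k: "P k" "\<And>j. P j \<Longrightarrow> j \<le> k" "k \<ge> 1"
      using Greatest_le_nat[of P _ "length u"] GreatestI_nat[of P 1 "length u"] by metis
    obtain v where v: "v \<in> lists S" "wp u = wp (v @ alt k)" "length v + k = length u"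
      using k by (auto simp: P_def)
    have minimal: "length u \<le> length z" if "z \<in> lists S" "wp z = wp u" for z
      using red_le less.prems(1) that by blast
    have redv: "red v"
    proof -
      have "red (v @ alt k)"
        using v less.prems(1) altS[of k] by (simp add: red_def) (simp add: alt_def)
      then show ?thesis by (rule red_append)
    qed
    have step: "alt (Suc j) = (if even j then t else s) # alt j" for j
      by (simp add: alt_def alternating_Suc_snoc del: alternating.simps)
    \<comment> \<open>If \<open>x\<close> were a descent of \<open>v\<close>, then \<open>v\<close>
      could be rewritten to end in \<open>x\<close>. By parity \<open>x\<close> either prolongs the
      alternating suffix, against maximality of \<open>k\<close>, or cancels its first letter,
      against reducedness of \<open>u\<close>.\<close>
    have up: "len (v @ [x]) > len v" if x: "x \<in> {s, t}" for x
    proof (rule ccontr)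
      assume "\<not> ?thesis"
      moreover have xS: "x \<in> S" using x sS uS by auto
      ultimately have less: "len (v @ [x]) < len v"
        using len_snoc_le(3)[OF v(1) xS] by linarith
      obtain z where z: "z \<in> lists S" "wp z = wp (v @ [x])" "length z = len (v @ [x])"
        using shortest_word[of "v @ [x]"] v xS by auto
      have vz: "wp v = wp (z @ [x])" using z v xS by (simp add: wp_append m_assoc)
      show False
      proof (cases "x = (if even k then t else s)")
        case True
        have "P (Suc k)" unfolding P_def
        proof (intro bexI[of _ z] conjI)
          show "wp u = wp (z @ alt (Suc k))"
            unfolding step using True v(1,2) vz z xS wp_append_cong[of v "alt k" "z @ [x]" "alt k"] by auto
          have "length v = len v" using redv by (simp add: red_def)
          then show "length z + Suc k = length u"
            using v(3) z less len_snoc_le(2)[OF v(1) xS] by linarith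
        qed (use z in auto)
        then show False using k(2) by fastforce
      next
        case False
        then have x': "x = (if even (k - 1) then t else s)" using x k(3) by (cases k) auto
        have "alt k = x # alt (k - 1)" using step[of "k - 1"] x' k(3) by simp
        then have "wp u = wp (z @ alt (k - 1))"
          using v(1,2) z xS by (simp add: wp_append m_assoc)
        then have "length u \<le> length (z @ alt (k - 1))"
          using z(1) by (intro minimal) (simp_all del: length_append)
        moreover have "length v = len v" using redv by (simp add: red_def)
        ultimately show False using z less v(3) k(3) by (simp add: alt_def)
      qed
    qed
    \<comment> \<open>A suffix of length at least \<open>m s t\<close> could be turned by the braid
      relation into one ending in \<open>s\<close>, and then \<open>s\<close> would be a descent of
      \<open>u\<close>.\<close>
    have km: "m s t = 0 \<or> k < m s t"
    proof (rule ccontr)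
      assume *: "\<not> ?thesis"
      then obtain j where j: "k = m s t + j" "m s t \<noteq> 0" by (metis le_add_diff_inverse not_less)
      then obtain n where n: "m s t = Suc n" using not0_implies_Suc by blast
      define B where "B = rev (if even (m s t) then alternating t s j else alternating s t j)"
      have altk: "alt k = B @ rev (alternating t s (m s t))"
        unfolding alt_def j alternating_add by (simp add: B_def)
      have BS: "B \<in> lists S" using alternating_in_lists uS sS by (simp add: B_def)
      define C where "C = rev (alternating t s n)"
      have CS: "C \<in> lists S" using alternating_in_lists uS sS by (simp add: C_def)
      have "wp (rev (alternating t s (m s t))) = wp (C @ [s])"
        using wp_braid[OF sS uS(3)] by (simp add: n C_def)
      then have "wp u = wp (v @ B @ C @ [s])"
        using v(1,2) BS CS sS altk alternating_in_lists uS(3) by (simp add: wp_append)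
      then have "wp (u @ [s]) = wp (v @ B @ C)"
        using v(1) BS CS sS uS by (simp add: wp_append m_assoc)
      then have "len (u @ [s]) \<le> length (v @ B @ C)"
        using len_le_length[of "v @ B @ C"] v BS CS by simp
      moreover have "length (B @ C) + 1 = k" by (simp add: B_def C_def j n)
      ultimately have "len (u @ [s]) < length u" using v(3) by simp
      then show False using less.prems by (simp add: red_def)
    qed
    \<comment> \<open>The induction hypothesis makes both roots of \<open>v\<close> nonnegative, and
      the root of \<open>u\<close> is a combination of them with dihedral coefficients.\<close>
    have lv: "length v < length u" using v(3) k(3) by simp
    have pos: "nonneg (word_action v (simple_root x))" if "x \<in> {s, t}" for x
      using that sS uS by (intro less.hyps[OF lv redv _ up[OF that]]) auto
    have "word_action u = word_action (v @ alt k)"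
      by (rule word_action_cong[OF uS(1) _ v(2)]) (use v(1) in simp)
    then have "word_action u (simple_root s) =
       (\<lambda>i. dihedral_coeff (m s t) (Suc k) * word_action v (simple_root (if even k then s else t)) i
       + dihedral_coeff (m s t) k * word_action v (simple_root (if even k then t else s)) i)"
      unfolding word_action_append alt_def
      by (simp only: word_action_append word_action_alternating[OF sS uS(3) \<open>s \<noteq> t\<close>] word_action_linear)
    moreover have "dihedral_coeff (m s t) (Suc k) \<ge> 0" "dihedral_coeff (m s t) k \<ge> 0"
      using km m_neq_1[OF sS uS(3) \<open>s \<noteq> t\<close>] by (auto intro!: dihedral_coeff_nonneg)
    moreover have "nonneg (word_action v (simple_root (if even k then s else t)))"
       "nonneg (word_action v (simple_root (if even k then t else s)))"
      using pos by auto
    ultimately show ?thesis unfolding nonneg_def by simp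
  qed
qed

end

section \<open>Exchange, the longest element and Demazure products\<close>

context coxeter_presentation begin

abbreviation nonpos :: "('a \<Rightarrow> real) \<Rightarrow> bool" where
  "nonpos x \<equiv> nonneg (\<lambda>i. - x i)"

lemma word_action_snoc_same:
  "s \<in> S \<Longrightarrow> word_action (u @ [s]) (simple_root s) = (\<lambda>i. - word_action u (simple_root s) i)"
  by (simp add: reflection_simple_root_same word_action_uminus)

lemma root_nonpos:
  assumes "u \<in> lists S" "s \<in> S" "len (u @ [s]) < len u"
  shows "nonpos (word_action u (simple_root s))"
proof -
  obtain z where z: "red z" "wp z = wp (u @ [s])" using red_exists[of "u @ [s]"] assms by auto
  have zl: "z \<in> lists S" using z red_lists by blast
  have "wp (z @ [s]) = wp u" using z zl assms by (simp add: wp_append m_assoc)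
  then have "nonneg (word_action z (simple_root s))"
    using assms z by (intro root_nonneg) auto
  moreover have "word_action z = word_action (u @ [s])"
    by (rule word_action_cong[OF zl _ z(2)]) (use assms in simp)
  ultimately show ?thesis using word_action_snoc_same[OF assms(2)] by metis
qed

lemma root_nonneg':
  assumes "u \<in> lists S" "s \<in> S" "len (u @ [s]) > len u"
  shows "nonneg (word_action u (simple_root s))"
proof -
  obtain z where z: "red z" "wp z = wp u" using red_exists[of u] assms by auto
  have zl: "z \<in> lists S" using z red_lists by blast
  have "wp (z @ [s]) = wp (u @ [s])" using z zl assms by (simp add: wp_append)
  then have "nonneg (word_action z (simple_root s))"
    using assms z by (intro root_nonneg) auto
  then show ?thesis using word_action_cong[OF zl assms(1) z(2)] by simp
qed

text \<open>The action is invertible, so a root is not the zero vector.\<close>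

lemma root_not_both:
  assumes "u \<in> lists S" "nonneg (word_action u (simple_root s))" "nonpos (word_action u (simple_root s))"
  shows False
proof -
  have "word_action u (simple_root s) = (\<lambda>i. 0)"
    using assms(2,3) unfolding nonneg_def by (intro ext antisym) (auto simp: le_minus_iff)
  then have "simple_root s = word_action (rev u) (\<lambda>i. 0 * simple_root s i + 0 * simple_root s i)"
    using word_action_rev_cancel'[OF assms(1), of "simple_root s"] by simp
  then have "simple_root s s = 0" unfolding word_action_linear by simp
  then show False by (simp add: simple_root_def)
qed

lemma ascent_iff:
  assumes "u \<in> lists S" "s \<in> S"
  shows "len u < len (u @ [s]) \<longleftrightarrow> nonneg (word_action u (simple_root s))"
  using root_nonneg'[OF assms] root_nonpos[OF assms] root_not_both[OF assms(1)] len_snoc_le(3)[OF assms]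
  by (meson linorder_neqE_nat)

lemma descent_iff:
  assumes "u \<in> lists S" "s \<in> S"
  shows "len (u @ [s]) < len u \<longleftrightarrow> nonpos (word_action u (simple_root s))"
  using root_nonneg'[OF assms] root_nonpos[OF assms] root_not_both[OF assms(1)] len_snoc_le(3)[OF assms]
  by (meson linorder_neqE_nat)

lemma nonneg_or_nonpos:
  assumes "u \<in> lists S" "s \<in> S"
  shows "nonneg (word_action u (simple_root s)) \<or> nonpos (word_action u (simple_root s))"
  using ascent_iff[OF assms] descent_iff[OF assms] len_snoc_le(3)[OF assms] by linarith

text \<open>Lets reducedness be tested letter by letter through the signs of roots.\<close>

lemma red_snoc:
  "red (u @ [s]) \<longleftrightarrow> red u \<and> s \<in> S \<and> nonneg (word_action u (simple_root s))"
proof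
  assume r: "red (u @ [s])"
  then have "red u" by (rule red_append)
  moreover have "s \<in> S" "len u < len (u @ [s])" using r calculation by (auto simp: red_def)
  ultimately show "red u \<and> s \<in> S \<and> nonneg (word_action u (simple_root s))"
    using ascent_iff red_lists by blast
next
  assume r: "red u \<and> s \<in> S \<and> nonneg (word_action u (simple_root s))"
  then have "len u < len (u @ [s])" using ascent_iff red_lists by blast
  then have "len (u @ [s]) = len u + 1" using r len_snoc_le(1)[of u s] red_lists by fastforce
  then show "red (u @ [s])" using r by (auto simp: red_def)
qed

text \<open>Faithfulness of the geometric representation: a nonempty reduced word sends the simple
  root of its last letter to a nonpositive vector and so does not act as the identity.\<close>

lemma wp_eqI_actions:
  assumes "u \<in> lists S" "v \<in> lists S" "\<And>s. s \<in> S \<Longrightarrow> word_action u (simple_root s) = word_action v (simple_root s)"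
  shows "wp u = wp v"
proof -
  obtain z where z: "red z" "wp z = wp (rev v @ u)" using red_exists[of "rev v @ u"] assms by auto
  have zl: "z \<in> lists S" using z red_lists by blast
  have act: "word_action z (simple_root s) = simple_root s" if "s \<in> S" for s
  proof -
    have "word_action z = word_action (rev v @ u)"
      by (rule word_action_cong[OF zl _ z(2)]) (use assms in simp)
    then show ?thesis using assms that word_action_rev_cancel'[OF assms(2)] by simp
  qed
  have "z = []"
  proof (cases z rule: rev_cases)
    case (snoc z' s)
    then have s: "s \<in> S" "nonneg (word_action z' (simple_root s))" using z red_snoc by auto
    then have "nonpos (word_action z (simple_root s))"
      unfolding snoc word_action_snoc_same[OF s(1)] by simp
    then show ?thesis using act[OF s(1)] by (auto simp: nonneg_def simple_root_def dest!: spec[of _ s])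
  qed
  then have "inv (wp v) \<otimes> wp u = \<one>" using z assms by (simp add: wp_append wp_rev)
  then have "inv (inv (wp v)) = wp u" using assms
    by (metis inv_closed inv_comm inv_equality wp_closed)
  then show ?thesis using assms by simp
qed

section \<open>The invariant bilinear form, the exchange condition and commuting generators\<close>

definition form :: "('a \<Rightarrow> real) \<Rightarrow> ('a \<Rightarrow> real) \<Rightarrow> real" where
  "form x y = (\<Sum>i\<in>S. x i * pairing i y)"

lemma pairing_reflection: "s \<in> S \<Longrightarrow> pairing i (reflection s y) = pairing i y - A i s * pairing s y"
  by (simp add: reflection_def pairing_upd)

lemma sum_upd:
  fixes x z :: "'a \<Rightarrow> real"
  assumes "s \<in> S"
  shows "(\<Sum>i\<in>S. (x(s := x s - d)) i * z i) = (\<Sum>i\<in>S. x i * z i) - d * z s"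
proof -
  have "(\<Sum>i\<in>S. (x(s := x s - d)) i * z i) = (\<Sum>i\<in>S. x i * z i - (if i = s then d * z s else 0))"
    by (rule sum.cong) (auto simp: algebra_simps)
  then show ?thesis using assms finite_S by (simp add: sum_subtractf sum.delta)
qed

lemma pairing_eq_form: "s \<in> S \<Longrightarrow> form x (simple_root s) = pairing s x"
  unfolding form_def pairing_def[of s x]
  by (intro sum.cong) (auto simp: pairing_simple_root A_sym)

lemma form_reflection:
  assumes "s \<in> S" shows "form (reflection s x) (reflection s y) = form x y"
proof -
  have "form (reflection s x) (reflection s y)
      = (\<Sum>i\<in>S. x i * pairing i (reflection s y)) - pairing s x * pairing s (reflection s y)"
    unfolding form_def reflection_def[of s x] by (rule sum_upd[OF assms])
  also have "pairing s (reflection s y) = - pairing s y"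
    using assms by (simp add: pairing_reflection)
  also have "(\<Sum>i\<in>S. x i * pairing i (reflection s y)) = form x y - (\<Sum>i\<in>S. x i * A i s) * pairing s y"
    using assms by (simp add: pairing_reflection form_def algebra_simps sum_subtractf sum_distrib_left)
  also have "(\<Sum>i\<in>S. x i * A i s) = pairing s x"
    unfolding pairing_def using assms by (intro sum.cong) (auto simp: A_sym)
  finally show ?thesis by simp
qed

lemma form_word_action: "Q \<in> lists S \<Longrightarrow> form (word_action Q x) (word_action Q y) = form x y"
  by (induction Q) (auto simp: form_reflection)

lemma reflection_form:
  "s \<in> S \<Longrightarrow> reflection s z = (\<lambda>i. 1 * z i + (- form z (simple_root s)) * simple_root s i)"
  by (auto simp: reflection_def pairing_eq_form simple_root_def)

text \<open>Conjugating a reflection gives the reflection in the transported root, because the form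
  is invariant; faithfulness turns the equality of actions into one in the group.\<close>

lemma wp_conjugate_gen:
  assumes "Y \<in> lists S" "s \<in> S" "q \<in> S" "word_action Y (simple_root s) = simple_root q"
  shows "wp (q # Y) = wp (Y @ [s])"
proof -
  have "word_action (q # Y) x = word_action (Y @ [s]) x" for x
  proof -
    have "word_action (Y @ [s]) x = (\<lambda>i. 1 * word_action Y x i + (- form x (simple_root s)) * simple_root q i)"
      using assms by (simp only: word_action_append word_action_Cons word_action_Nil
          reflection_form[OF assms(2)] word_action_linear)
    also have "form x (simple_root s) = form (word_action Y x) (simple_root q)"
      using form_word_action[OF assms(1), of x "simple_root s"] assms(4) by simp
    finally show ?thesis using reflection_form[OF assms(3), of "word_action Y x"] by simp
  qed
  then show ?thesis using assms by (intro wp_eqI_actions) auto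
qed

text \<open>The simple root is positive before any letter acts and negative after the whole word, so
  some letter \<open>q\<close> changes its sign. The root met there can only be the simple root of
  \<open>q\<close>.\<close>

lemma exchange:
  assumes "u \<in> lists S" "s \<in> S" "nonpos (word_action u (simple_root s))"
  obtains X q Y where "u = X @ q # Y" "word_action Y (simple_root s) = simple_root q"
    "wp (q # Y) = wp (Y @ [s])"
  using assms
proof (induction u arbitrary: thesis)
  case Nil
  then show ?case by (auto simp: nonneg_def simple_root_def dest!: spec[of _ s])
next
  case (Cons q u)
  have uS: "u \<in> lists S" "q \<in> S" using Cons by auto
  show ?case
  proof (cases "nonpos (word_action u (simple_root s))")
    case True
    then obtain X q' Y where "u = X @ q' # Y" "word_action Y (simple_root s) = simple_root q'"
      "wp (q' # Y) = wp (Y @ [s])" using Cons.IH uS \<open>s \<in> S\<close> by blast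
    then show ?thesis using Cons.prems(1)[of "q # X"] by simp
  next
    case False
    define y where "y = word_action u (simple_root s)"
    have y: "nonneg y" using False nonneg_or_nonpos uS Cons.prems by (auto simp: y_def)
    \<comment> \<open>\<open>reflection q\<close> changes coordinate \<open>q\<close> alone, so all
      other coordinates of \<open>y\<close> vanish. As the form is invariant and has value 2 on
      simple roots, the remaining coordinate is 1.\<close>
    have "nonpos (reflection q y)" using Cons.prems by (simp add: y_def)
    then have "y i = 0" if "i \<noteq> q" for i
      using y that unfolding nonneg_def by (metis antisym neg_0_le_iff_le reflection_other)
    then have yq: "y = (\<lambda>i. y q * simple_root q i + 0 * simple_root q i)"
      by (auto simp: simple_root_def)
    have "form y y = form (simple_root s) (simple_root s)"
      unfolding y_def by (rule form_word_action[OF uS(1)])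
    also have "\<dots> = 2" using Cons.prems by (simp add: pairing_eq_form pairing_simple_root)
    finally have "form y y = 2" .
    moreover have "form y y = y q * pairing q y"
    proof -
      have "form y y = (\<Sum>i\<in>S. if i = q then y q * pairing q y else 0)"
        unfolding form_def by (rule sum.cong) (use \<open>\<And>i. i \<noteq> q \<Longrightarrow> y i = 0\<close> in auto)
      then show ?thesis using uS finite_S by simp
    qed
    moreover have "pairing q y = 2 * y q"
      using uS by (subst yq, subst pairing_linear) (simp add: pairing_simple_root)
    ultimately have "(y q)\<^sup>2 = 1" by (simp add: power2_eq_square)
    then have "y q = 1" using y by (auto simp: power2_eq_1_iff nonneg_def dest!: spec[of _ q])
    then have "y = simple_root q" using yq by simp
    then show ?thesis
      using Cons.prems(1)[of "[]" q u] wp_conjugate_gen[OF uS(1) \<open>s \<in> S\<close> uS(2)] by (simp add: y_def)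
  qed
qed

lemma reflection_commute:
  assumes "s \<in> S" "t \<in> S" "s \<noteq> t" "A s t = 0"
  shows "reflection s (reflection t x) = reflection t (reflection s x)"
proof -
  have "A t s = 0" using assms A_sym by metis
  then have "pairing s (reflection t x) = pairing s x" "pairing t (reflection s x) = pairing t x"
    using assms by (simp_all add: pairing_reflection)
  then show ?thesis using assms(3) unfolding reflection_def by (auto simp: fun_eq_iff)
qed

text \<open>For the forward direction the two products are compared at coordinate \<open>t\<close>
  of the images of \<open>simple_root s\<close>, which are \<open>A t s\<close> with opposite signs.
  The converse is faithfulness.\<close>

lemma commuting_iff:
  assumes "s \<in> S" "t \<in> S" "s \<noteq> t"
  shows "commuting W s t \<longleftrightarrow> A s t = 0"
proof
  assume "commuting W s t"
  then have "wp [s, t] = wp [t, s]" using assms by (simp add: commuting_def)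
  then have "word_action [s, t] = word_action [t, s]" using assms by (intro word_action_cong) auto
  then have "reflection s (reflection t (simple_root s)) t = reflection t (reflection s (simple_root s)) t"
    by (metis word_action_Cons word_action_Nil)
  moreover have "reflection s (reflection t (simple_root s)) t = - A t s"
    using assms by (simp add: reflection_simple_root) (simp add: simple_root_def)
  moreover have "reflection t (reflection s (simple_root s)) t = A t s"
    using assms by (simp add: reflection_simple_root_same reflection_uminus) (simp add: reflection_simple_root simple_root_def)
  ultimately show "A s t = 0" using A_sym assms by simp
next
  assume "A s t = 0"
  then have "wp [s, t] = wp [t, s]" 
    using assms by (intro wp_eqI_actions) (auto simp: reflection_commute[OF assms])
  then show "commuting W s t" using assms by (simp add: commuting_def)
qed

lemma commuting_sym: "commuting W s t \<longleftrightarrow> commuting W t s"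
  by (auto simp: commuting_def)

lemma reflection_fix_commuting:
  assumes "s \<in> S" "t \<in> S" "s \<noteq> t" "commuting W s t"
  shows "reflection s (simple_root t) = simple_root t"
  using assms commuting_iff by (simp add: reflection_simple_root)

lemma A_nonpos: "s \<in> S \<Longrightarrow> t \<in> S \<Longrightarrow> s \<noteq> t \<Longrightarrow> A s t \<le> 0"
  using coxeter_entry_nonpos m_neq_1 by blast

lemma reflection_sum:
  "finite K \<Longrightarrow> reflection s (\<lambda>i. \<Sum>k\<in>K. c k * y k i) = (\<lambda>i. \<Sum>k\<in>K. c k * reflection s (y k) i)"
proof (induction K rule: finite_induct)
  case empty
  then show ?case using reflection_linear[of s 0 undefined 0 undefined] by simp
next
  case (insert k K)
  have "reflection s (\<lambda>i. c k * y k i + 1 * (\<Sum>k\<in>K. c k * y k i))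
      = (\<lambda>i. c k * reflection s (y k) i + 1 * reflection s (\<lambda>i. \<Sum>k\<in>K. c k * y k i) i)"
    by (rule reflection_linear)
  then show ?case using insert by simp
qed

lemma word_action_expand:
  assumes "\<And>i. i \<notin> S \<Longrightarrow> x i = 0"
  shows "word_action u x = (\<lambda>i. \<Sum>s\<in>S. x s * word_action u (simple_root s) i)"
proof (induction u)
  case Nil
  have "x i = (\<Sum>s\<in>S. x s * simple_root s i)" for i
    using assms finite_S by (cases "i \<in> S") (auto simp: simple_root_def if_distrib sum.delta' cong: if_cong)
  then show ?case unfolding word_action_Nil by (rule ext)
qed (simp add: reflection_sum finite_S)

section \<open>Elements with all generators as descents, and the longest element\<close>

definition full_descent :: "'a list \<Rightarrow> bool" where
  "full_descent u \<longleftrightarrow> u \<in> lists S \<and> (\<forall>s\<in>S. nonpos (word_action u (simple_root s)))"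

lemma full_descent_nonneg:
  assumes "full_descent u" "nonneg x" "\<And>i. i \<notin> S \<Longrightarrow> x i = 0"
  shows "nonpos (word_action u x)"
proof -
  have "word_action u x i \<le> 0" for i
    using assms(1,2) fun_cong[OF word_action_expand[of x u], of i] assms(3)
    by (auto simp: full_descent_def nonneg_def intro!: sum_nonpos mult_nonneg_nonpos)
  then show ?thesis by (simp add: nonneg_def)
qed

text \<open>\<open>u\<close> sends nonnegative vectors to nonpositive ones, so each ascent met while
  building up \<open>v\<close> becomes a descent after \<open>u\<close>.\<close>

lemma full_descent_len:
  assumes "full_descent u" "red v"
  shows "len (u @ v) + length v = len u"
  using assms(2)
proof (induction v rule: rev_induct)
  case (snoc s v)
  have uS: "u \<in> lists S" using assms by (simp add: full_descent_def)
  have v: "red v" "s \<in> S" "nonneg (word_action v (simple_root s))" using snoc.prems red_snoc by auto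
  then have vS: "v \<in> lists S" using red_lists by blast
  have "word_action v (simple_root s) i = 0" if "i \<notin> S" for i
  proof -
    have "i \<notin> set v" "i \<noteq> s" using vS v that by auto
    then show ?thesis by (simp add: word_action_notin simple_root_def)
  qed
  then have "nonpos (word_action (u @ v) (simple_root s))"
    using full_descent_nonneg[OF assms(1) v(3)] by simp
  then have "len ((u @ v) @ [s]) < len (u @ v)"
    using descent_iff[of "u @ v" s] uS vS v by simp
  moreover have "len (u @ v) \<le> len ((u @ v) @ [s]) + 1" using len_snoc_le(2)[of "u @ v" s] uS vS v by simp
  ultimately show ?case using snoc.IH v by simp
qed simp

abbreviation w0 :: 'a where "w0 \<equiv> longest_element W S"

lemma len_wp_one: "cox_length W S \<one> = 0"
  using len_le_length[of "[]"] by simp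

lemma len_eq_0: "u \<in> lists S \<Longrightarrow> len u = 0 \<Longrightarrow> wp u = \<one>"
  by (metis length_0_conv shortest_word wp_Nil)

text \<open>The length of \<open>u v\<close> is the difference of the two lengths; if it is 0, then
  \<open>u v\<close> represents the identity.\<close>

lemma full_descent_max:
  assumes "full_descent u" "v \<in> lists S"
  shows "len v \<le> len u" "len v = len u \<Longrightarrow> wp v = inv (wp u)"
proof -
  have uS: "u \<in> lists S" using assms by (simp add: full_descent_def)
  obtain z where z: "red z" "wp z = wp v" using red_exists assms by blast
  have zS: "z \<in> lists S" using z red_lists by blast
  have l: "len (u @ z) + len v = len u" using full_descent_len[OF assms(1) z(1)] z by (simp add: red_def)
  then show "len v \<le> len u" by simp
  assume "len v = len u"
  then have "wp (u @ z) = \<one>" using len_eq_0[of "u @ z"] l uS zS by simp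
  then have "wp u \<otimes> wp v = \<one>" using uS zS z by (simp add: wp_append)
  then show "wp v = inv (wp u)" using uS assms
    by (metis inv_comm inv_equality wp_closed)
qed

lemma full_descent_longest:
  assumes "full_descent u" shows "wp u = w0"
proof -
  have uS: "u \<in> lists S" using assms by (simp add: full_descent_def)
  have iu: "inv (wp u) = wp u" using full_descent_max(2)[OF assms uS] by simp
  show ?thesis unfolding longest_element_def
  proof (rule the_equality[symmetric])
    show "wp u \<in> carrier W \<and> (\<forall>v\<in>carrier W. cox_length W S v \<le> len u)"
      using uS full_descent_max(1)[OF assms] wp_surj by (metis wp_closed)
    fix w assume w: "w \<in> carrier W \<and> (\<forall>v\<in>carrier W. cox_length W S v \<le> cox_length W S w)"
    then obtain v where v: "v \<in> lists S" "wp v = w" using wp_surj by blast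
    then have "len v = len u" using w uS full_descent_max(1)[OF assms v(1)] by (simp add: antisym)
    then show "w = wp u" using full_descent_max(2)[OF assms v(1)] v iu by simp
  qed
qed

lemma len_bounded: "\<exists>n. \<forall>u\<in>lists S. len u \<le> n"
proof -
  have "\<forall>u\<in>lists S. len u \<le> Max (cox_length W S ` carrier W)"
    using finite_carrier by (auto intro!: Max_ge)
  then show ?thesis by blast
qed

lemma w0_word: obtains u where "red u" "wp u = w0" "full_descent u"
proof -
  obtain n where n: "\<forall>u\<in>lists S. len u \<le> n" using len_bounded by blast
  have "\<exists>u. u \<in> lists S \<and> (\<forall>v. v \<in> lists S \<longrightarrow> len v \<le> len u)"
    using ex_has_greatest_nat[of "\<lambda>u. u \<in> lists S" "[]" len "Suc n"] n
    by (metis lists.Nil le_imp_less_Suc)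
  then obtain u' where u': "u' \<in> lists S" "\<And>v. v \<in> lists S \<Longrightarrow> len v \<le> len u'" by blast
  obtain u where u: "red u" "wp u = wp u'" using red_exists u' by blast
  have uS: "u \<in> lists S" using u red_lists by blast
  have "full_descent u" unfolding full_descent_def
  proof (intro conjI ballI uS)
    fix s assume s: "s \<in> S"
    then have "len (u @ [s]) \<le> len u" using u'(2)[of "u @ [s]"] u uS by simp
    then have "len (u @ [s]) < len u" using len_snoc_le(3)[OF uS s] by simp
    then show "nonpos (word_action u (simple_root s))" using descent_iff uS s by blast
  qed
  then show ?thesis using that u full_descent_longest by blast
qed

lemma full_descent_iff:
  assumes "u \<in> lists S" shows "full_descent u \<longleftrightarrow> wp u = w0"
proof
  assume "wp u = w0"
  then obtain v where v: "red v" "wp v = wp u" "full_descent v" using w0_word by metis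
  then have "word_action u = word_action v" using word_action_cong assms red_lists by metis
  then show "full_descent u" using v assms by (simp add: full_descent_def)
qed (rule full_descent_longest)

lemma w0_closed [simp]: "w0 \<in> carrier W"
  using w0_word by (metis red_lists wp_closed)

lemma inv_w0: "inv w0 = w0"
  using w0_word full_descent_max(2) red_lists by metis

lemma red_w0_prefix:
  assumes "red (X @ B)" "wp B = w0" shows "X = []"
proof -
  have r: "red X" "red B" using red_append[OF assms(1)] by auto
  then have l: "X \<in> lists S" "B \<in> lists S" using red_lists by auto
  then have "full_descent B" using assms full_descent_iff by blast
  then have "len (X @ B) \<le> len B" using full_descent_max(1)[of B "X @ B"] l by simp
  then have "length X + length B \<le> length B" using assms(1) r by (simp add: red_def)
  then show ?thesis by simp
qed

lemma red_rev: "red u \<Longrightarrow> red (rev u)"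
proof -
  assume r: "red u"
  then have uS: "u \<in> lists S" using red_lists by blast
  obtain v where v: "red v" "wp v = wp (rev u)" using red_exists[of "rev u"] uS by auto
  then have "wp (rev v) = wp u" using red_lists[OF v(1)] uS by (simp add: wp_rev)
  then have "length u \<le> length v" using red_le[OF r, of "rev v"] red_lists[OF v(1)] by simp
  then show "red (rev u)" using v uS len_le_length[of "rev u"] by (simp add: red_def)
qed

section \<open>Conjugation by the longest element\<close>

abbreviation \<psi> :: "'a \<Rightarrow> 'a" where "\<psi> \<equiv> psi W S"

lemma psi_eq: "s \<in> S \<Longrightarrow> \<psi> s = w0 \<otimes> s \<otimes> w0"
  by (simp add: psi_def inv_w0)

lemma psi_psi: assumes "s \<in> S" shows "w0 \<otimes> \<psi> s \<otimes> w0 = s"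
proof -
  have w: "w0 \<otimes> w0 = \<one>" using r_inv[OF w0_closed] inv_w0 by simp
  have w': "w0 \<otimes> (w0 \<otimes> g) = g" if "g \<in> carrier W" for g
    using m_assoc[of w0 w0 g] w that by simp
  show ?thesis using assms w w' by (simp add: psi_eq m_assoc)
qed

text \<open>\<open>w0 s w0\<close> is \<open>w0\<close> times the inverse of \<open>w0 s\<close>.
  The length of \<open>w0 s\<close> is one below the maximum, so by \<open>full_descent_len\<close>
  this product has length 1.\<close>

lemma psi_in_S: assumes s: "s \<in> S" shows "\<psi> s \<in> S"
proof -
  obtain u where u: "red u" "wp u = w0" "full_descent u" using w0_word by blast
  have uS: "u \<in> lists S" using u red_lists by blast
  obtain z where z: "red z" "wp z = wp (u @ [s])" using red_exists[of "u @ [s]"] uS s by auto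
  have zS: "z \<in> lists S" using z red_lists by blast
  have "len (u @ [s]) < len u" 
    using descent_iff[OF uS s] u(3) s unfolding full_descent_def by blast
  then have "length z + 1 = len u" using len_snoc_le(2)[OF uS s] z by (simp add: red_def)
  moreover have "len (u @ rev z) + length (rev z) = len u" using full_descent_len[OF u(3) red_rev[OF z(1)]] .
  ultimately have l1: "len (u @ rev z) = 1" by simp
  obtain v where v: "v \<in> lists S" "wp v = wp (u @ rev z)" "length v = 1"
    using shortest_word[of "u @ rev z"] l1 uS zS by auto
  then obtain r where r: "v = [r]" "r \<in> S" by (auto simp: length_Suc_conv)
  have "wp (u @ rev z) = \<psi> s"
    using uS zS z s u by (simp add: wp_append wp_rev inv_mult_group inv_gen inv_w0 psi_eq m_assoc)
  then show ?thesis using v r by simp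
qed

lemma inj_psi: "inj_on \<psi> S"
  by (rule inj_onI) (metis psi_psi)

lemma psi_image: "\<psi> ` S = S"
  using psi_in_S inj_psi finite_S by (intro endo_inj_surj) auto

lemma psi_involution: "s \<in> S \<Longrightarrow> \<psi> (\<psi> s) = s"
  using psi_psi psi_eq psi_in_S by metis

lemma commuting_psi:
  assumes "s \<in> S" "t \<in> S" shows "commuting W (\<psi> s) (\<psi> t) \<longleftrightarrow> commuting W s t"
proof -
  have w: "w0 \<otimes> w0 = \<one>" using r_inv[OF w0_closed] inv_w0 by simp
  have w': "w0 \<otimes> (w0 \<otimes> g) = g" if "g \<in> carrier W" for g
    using m_assoc[of w0 w0 g] w that by simp
  have "\<psi> a \<otimes> \<psi> b = w0 \<otimes> (a \<otimes> b) \<otimes> w0" if "a \<in> S" "b \<in> S" for a b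
    using that w' by (simp add: psi_eq m_assoc)
  then show ?thesis using assms by (simp add: commuting_def)
qed

section \<open>Demazure products\<close>

lemma demazure_red:
  assumes "Q \<in> lists S"
  shows "\<exists>u. red u \<and> wp u = demazure W S Q \<and> set u \<subseteq> set Q \<and> length u \<le> length Q"
  using assms
proof (induction Q rule: rev_induct)
  case Nil
  then show ?case by (intro exI[of _ "[]"]) (simp add: demazure_Nil red_def len_wp_one)
next
  case (snoc s Q)
  then obtain u where u: "red u" "wp u = demazure W S Q" "set u \<subseteq> set Q" "length u \<le> length Q" by auto
  have s: "s \<in> S" "u \<in> lists S" using snoc u red_lists by auto
  have us: "demazure W S Q \<otimes> s = wp (u @ [s])" using u s by (simp add: wp_append)
  show ?case
  proof (cases "len (u @ [s]) > len u")
    case True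
    then have "red (u @ [s])" using red_snoc ascent_iff s u by blast
    then show ?thesis using True u us by (intro exI[of _ "u @ [s]"]) (auto simp: demazure_snoc)
  next
    case False
    then show ?thesis using u us by (intro exI[of _ u]) (auto simp: demazure_snoc)
  qed
qed

text \<open>Whenever the Demazure product ignores a letter \<open>s\<close>, the exchange condition
  rewrites the current element to end in \<open>s\<close> at the cost of one earlier letter. As
  \<open>B s\<close> is reduced, the deleted letter lies in \<open>X\<close>, so the suffix
  survives.\<close>

lemma demazure_suffix:
  assumes "Q \<in> lists S" "red B"
  shows "\<exists>X. red (X @ B) \<and> wp (X @ B) = demazure W S (Q @ B)"
  using assms(2)
proof (induction B rule: rev_induct)
  case Nil
  then show ?case using demazure_red[OF assms(1)] by auto
next
  case (snoc s B)
  have B: "red B" "s \<in> S" "nonneg (word_action B (simple_root s))" using snoc red_snoc by auto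
  have BS: "B \<in> lists S" using B red_lists by blast
  obtain X where X: "red (X @ B)" "wp (X @ B) = demazure W S (Q @ B)" using snoc B by auto
  have XS: "X \<in> lists S" using X red_lists by fastforce
  have us: "demazure W S (Q @ B) \<otimes> s = wp ((X @ B) @ [s])" 
    using X(2)[symmetric] XS BS B(2) by (simp add: wp_append m_assoc)
  have dem: "demazure W S (Q @ B @ [s]) =
      (if len ((X @ B) @ [s]) > len (X @ B) then wp ((X @ B) @ [s]) else wp (X @ B))"
    using demazure_snoc[of W S "Q @ B" s] unfolding us unfolding X(2)[symmetric] by simp
  show ?case
  proof (cases "len ((X @ B) @ [s]) > len (X @ B)")
    case True
    then have "red ((X @ B) @ [s])" 
      using red_snoc[of "X @ B" s] ascent_iff[of "X @ B" s] BS XS B(2) X(1) by simp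
    then show ?thesis using True dem by (intro exI[of _ X]) auto
  next
    case False
    then have "nonpos (word_action X (word_action B (simple_root s)))"
      using nonneg_or_nonpos[of "X @ B" s] ascent_iff[of "X @ B" s] XS BS B by auto
    then obtain X' q Y where e: "X @ B = X' @ q # Y" "word_action Y (simple_root s) = simple_root q"
      "wp (q # Y) = wp (Y @ [s])"
      using exchange[of "X @ B" s] XS BS B by auto
    have YS: "Y \<in> lists S" "q \<in> S" "X' \<in> lists S" 
      using e(1) XS BS by (metis append_in_lists_conv listsE)+
    \<comment> \<open>If the exchanged letter were in \<open>B = C q Y\<close>, the positive root of
      \<open>B\<close> at \<open>s\<close> would be the negative of the root of \<open>C\<close> at
      \<open>q\<close>, which is positive because \<open>C q\<close> is reduced.\<close>
    have "length Y \<ge> length B"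
    proof (rule ccontr)
      assume "\<not> ?thesis"
      then obtain C where C: "B = C @ q # Y"
        using e(1) by (auto simp: append_eq_append_conv2 Cons_eq_append_conv append_eq_Cons_conv)
      have CS: "C \<in> lists S" using BS C by simp
      have "word_action B (simple_root s) = (\<lambda>i. - word_action C (simple_root q) i)"
        using C e(2) YS by (simp add: reflection_simple_root_same word_action_uminus)
      then have "nonpos (word_action C (simple_root q))" using B(3) by simp
      moreover have "red (C @ [q])" using B(1) C red_append(1)[of "C @ [q]" Y] by simp
      ultimately show False using red_snoc root_not_both CS by blast
    qed
    then obtain C where C: "X = X' @ q # C" "Y = C @ B"
      using e(1) by (auto simp: append_eq_append_conv2 Cons_eq_append_conv append_eq_Cons_conv)
    have CS: "C \<in> lists S" using YS C by simp
    have "wp (X @ B) = wp ((X' @ C) @ B @ [s])"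
      using e(3) YS CS BS B(2) unfolding C by (simp add: wp_append m_assoc)
    moreover have "length (X @ B) = length ((X' @ C) @ B @ [s])" unfolding C by simp
    moreover have "(X' @ C) @ B @ [s] \<in> lists S" using YS CS BS B by simp
    ultimately have "red ((X' @ C) @ B @ [s])" using X(1) by (simp add: red_def)
    then show ?thesis using dem False \<open>wp (X @ B) = wp ((X' @ C) @ B @ [s])\<close> by (intro exI[of _ "X' @ C"]) auto
  qed
qed

lemma demazure_w0:
  assumes "Q \<in> lists S" "red B" "wp B = w0"
  shows "demazure W S (Q @ B) = w0"
  using demazure_suffix[OF assms(1,2)] red_w0_prefix[OF _ assms(3)] assms(3) by fastforce

text \<open>A commuting letter fixes the simple root of the other one, so whether each of the two is
  accepted depends only on \<open>xs\<close>.\<close>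

lemma demazure_commute:
  assumes "xs \<in> lists S" "s \<in> S" "t \<in> S" "commuting W s t"
  shows "demazure W S (xs @ [s, t] @ ys) = demazure W S (xs @ [t, s] @ ys)"
proof (cases "s = t")
  case False
  obtain z where z: "red z" "wp z = demazure W S xs" using demazure_red[OF assms(1)] by blast
  have zS: "z \<in> lists S" using z red_lists by blast
  have *: "demazure W S (xs @ [a, b]) = wp (z @ (if nonneg (word_action z (simple_root a)) then [a] else [])
      @ (if nonneg (word_action z (simple_root b)) then [b] else []))"
    if ab: "a \<in> S" "b \<in> S" "a \<noteq> b" "commuting W a b" for a b
  proof -
    define z' where "z' = z @ (if nonneg (word_action z (simple_root a)) then [a] else [])"
    have z': "z' \<in> lists S" using zS ab by (simp add: z'_def)
    have "demazure W S (xs @ [a]) = wp z'"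
      using ascent_iff[OF zS ab(1)] zS ab by (simp add: demazure_snoc z(2)[symmetric] z'_def wp_append)
    moreover have "word_action z' (simple_root b) = word_action z (simple_root b)"
      using reflection_fix_commuting ab by (simp add: z'_def)
    ultimately have "demazure W S ((xs @ [a]) @ [b]) =
        wp (z' @ (if nonneg (word_action z (simple_root b)) then [b] else []))"
      using ascent_iff[OF z' ab(2)] z' ab by (simp only: demazure_snoc) (simp add: wp_append)
    then show ?thesis by (simp add: z'_def)
  qed
  have "wp (z @ [s, t]) = wp (z @ [t, s])"
    using assms zS by (intro wp_append_cong) (auto simp: commuting_def)
  then have "demazure W S (xs @ [s, t]) = demazure W S (xs @ [t, s])"
    using *[of s t] *[of t s] assms False commuting_sym[of s t] by auto
  then show ?thesis by (simp add: demazure_def)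
qed simp

end

section \<open>Firing sequences and the Euler form\<close>

context coxeter_presentation begin

definition nbr :: "'a \<Rightarrow> 'a \<Rightarrow> bool" where
  "nbr s t \<longleftrightarrow> s \<in> S \<and> t \<in> S \<and> s \<noteq> t \<and> \<not> commuting W s t"

lemma nbr_sym: "nbr s t \<longleftrightarrow> nbr t s"
  by (auto simp: nbr_def commuting_sym)

lemma nbr_irrefl [simp]: "\<not> nbr s s" by (simp add: nbr_def)

lemma nbr_A_neg: "nbr s t \<Longrightarrow> A s t < 0"
  using A_nonpos commuting_iff by (force simp: nbr_def)

lemma not_nbr_A: "s \<in> S \<Longrightarrow> t \<in> S \<Longrightarrow> s \<noteq> t \<Longrightarrow> \<not> nbr s t \<Longrightarrow> A s t = 0"
  using commuting_iff by (auto simp: nbr_def)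

lemma not_nbr_commuting: "s \<in> S \<Longrightarrow> t \<in> S \<Longrightarrow> \<not> nbr s t \<Longrightarrow> commuting W s t"
  by (auto simp: nbr_def commuting_def)

text \<open>\<open>d s x\<close> stands for an arrow from \<open>s\<close> to \<open>x\<close>. Only
  its values on edges of the Coxeter graph carry meaning.\<close>

definition source :: "('a \<Rightarrow> 'a \<Rightarrow> bool) \<Rightarrow> 'a \<Rightarrow> bool" where
  "source d s \<longleftrightarrow> s \<in> S \<and> (\<forall>x. nbr s x \<longrightarrow> d s x \<and> \<not> d x s)"

definition fire :: "'a \<Rightarrow> ('a \<Rightarrow> 'a \<Rightarrow> bool) \<Rightarrow> 'a \<Rightarrow> 'a \<Rightarrow> bool" where
  "fire s d x y = (if nbr x y \<and> x = s then False else if nbr x y \<and> y = s then True else d x y)"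

primrec fires :: "('a \<Rightarrow> 'a \<Rightarrow> bool) \<Rightarrow> 'a list \<Rightarrow> bool" where
  "fires d [] \<longleftrightarrow> True"
| "fires d (s # Q) \<longleftrightarrow> source d s \<and> fires (fire s d) Q"

primrec run :: "('a \<Rightarrow> 'a \<Rightarrow> bool) \<Rightarrow> 'a list \<Rightarrow> 'a \<Rightarrow> 'a \<Rightarrow> bool" where
  "run d [] = d"
| "run d (s # Q) = run (fire s d) Q"

lemma run_append [simp]: "run d (P @ Q) = run (run d P) Q"
  by (induction P arbitrary: d) auto

lemma fires_append [simp]: "fires d (P @ Q) \<longleftrightarrow> fires d P \<and> fires (run d P) Q"
  by (induction P arbitrary: d) auto

lemma fires_lists: "fires d Q \<Longrightarrow> Q \<in> lists S"
  by (induction Q arbitrary: d) (auto simp: source_def)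

text \<open>The diagonal receives half of \<open>A i i\<close>, and each edge puts its whole entry
  at one of the two places. The choice makes the row of a source a unit vector.\<close>

definition euler_coeff :: "('a \<Rightarrow> 'a \<Rightarrow> bool) \<Rightarrow> 'a \<Rightarrow> 'a \<Rightarrow> real" where
  "euler_coeff d i j = (if i = j then 1 else if nbr i j \<and> d j i then A i j else 0)"

text \<open>The symmetrization of the Euler form is the invariant form, whatever the orientation.\<close>

definition euler :: "('a \<Rightarrow> 'a \<Rightarrow> bool) \<Rightarrow> ('a \<Rightarrow> real) \<Rightarrow> ('a \<Rightarrow> real) \<Rightarrow> real" where
  "euler d x y = (\<Sum>i\<in>S. x i * (\<Sum>j\<in>S. y j * euler_coeff d i j))"

lemma euler_coeff_source:
  assumes "source d s"
  shows "euler_coeff d s j = (if j = s then 1 else 0)"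
    and "i \<in> S \<Longrightarrow> euler_coeff d i s = A i s - (if i = s then 1 else 0)"
  using assms not_nbr_A[of i s] by (auto simp: euler_coeff_def source_def nbr_sym[of i s] A_sym)

lemma euler_coeff_fire:
  assumes "source d s" "i \<in> S" "j \<in> S"
  shows "euler_coeff (fire s d) i j
    = euler_coeff d i j + ((if i = s then A s j else 0) - (if j = s then A i s else 0))"
  using assms not_nbr_A[of s j] not_nbr_A[of i s]
  by (auto simp: euler_coeff_def fire_def source_def nbr_sym[of i s] nbr_sym[of j s])

text \<open>The numerical form of the invariance under reflection functors at a source. Both sides
  reduce to the Euler form of \<open>d\<close> at \<open>x\<close>, \<open>y\<close> plus
  \<open>q * x s - p * y s\<close>, where \<open>p\<close> and \<open>q\<close> are the two pairings
  with \<open>s\<close>.\<close>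

lemma euler_fire:
  assumes "source d s"
  shows "euler d (reflection s x) (reflection s y) = euler (fire s d) x y"
proof -
  have s: "s \<in> S" using assms by (simp add: source_def)
  define p q where "p = pairing s x" and "q = pairing s y"
  define r where "r = (\<lambda>i. \<Sum>j\<in>S. y j * euler_coeff d i j)"
  have rs: "r s = y s"
    unfolding r_def euler_coeff_source(1)[OF assms] using s finite_S by (simp add: if_distrib cong: if_cong)
  have ry: "(\<Sum>j\<in>S. reflection s y j * euler_coeff d i j) = r i - q * euler_coeff d i s" for i
    unfolding r_def reflection_def q_def by (rule sum_upd[OF s])
  have pS: "(\<Sum>i\<in>S. x i * A i s) = p"
    unfolding p_def pairing_def using s by (intro sum.cong) (auto simp: A_sym)
  have qS: "(\<Sum>j\<in>S. y j * A s j) = q"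
    unfolding q_def pairing_def by (intro sum.cong) auto
  have "euler d (reflection s x) (reflection s y)
      = (\<Sum>i\<in>S. x i * (r i - q * euler_coeff d i s)) - p * (r s - q * euler_coeff d s s)"
    unfolding euler_def ry unfolding reflection_def p_def by (rule sum_upd[OF s])
  also have "(\<Sum>i\<in>S. x i * (r i - q * euler_coeff d i s))
      = (\<Sum>i\<in>S. x i * r i - q * (x i * A i s) + (if i = s then q * x s else 0))"
    by (intro sum.cong) (auto simp: euler_coeff_source(2)[OF assms] algebra_simps)
  also have "\<dots> = (\<Sum>i\<in>S. x i * r i) - q * p + q * x s"
    using s finite_S by (simp add: sum.distrib sum_subtractf sum_distrib_left[symmetric] pS)
  finally have lhs: "euler d (reflection s x) (reflection s y) = (\<Sum>i\<in>S. x i * r i) + q * x s - p * y s"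
    using rs by (simp add: euler_coeff_def algebra_simps)
  have "(\<Sum>j\<in>S. y j * euler_coeff (fire s d) i j) = r i + ((if i = s then q else 0) - y s * A i s)"
    if "i \<in> S" for i
  proof -
    have "(\<Sum>j\<in>S. y j * euler_coeff (fire s d) i j) =
       (\<Sum>j\<in>S. y j * euler_coeff d i j + ((if i = s then y j * A s j else 0) - (if j = s then y s * A i s else 0)))"
      by (intro sum.cong) (auto simp: euler_coeff_fire[OF assms that] algebra_simps)
    also have "\<dots> = r i + ((if i = s then q else 0) - y s * A i s)"
      using s finite_S by (auto simp: sum.distrib sum_subtractf r_def qS)
    finally show ?thesis .
  qed
  then have "euler (fire s d) x y = (\<Sum>i\<in>S. x i * (r i + ((if i = s then q else 0) - y s * A i s)))"
    unfolding euler_def by (intro sum.cong) auto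
  also have "\<dots> = (\<Sum>i\<in>S. x i * r i + ((if i = s then q * x s else 0) - y s * (x i * A i s)))"
    by (intro sum.cong) (auto simp: algebra_simps)
  also have "\<dots> = (\<Sum>i\<in>S. x i * r i) + (q * x s - y s * p)"
    using s finite_S by (simp add: sum.distrib sum_subtractf sum_distrib_left[symmetric] pS)
  finally show ?thesis using lhs by (simp add: algebra_simps)
qed

lemma euler_run: "fires d Q \<Longrightarrow> euler d (word_action Q x) (word_action Q y) = euler (run d Q) x y"
  by (induction Q arbitrary: d) (auto simp: euler_fire)

text \<open>The row of a source, like the column of a letter just fired in
  \<open>euler_fired\<close>, is a unit vector; so the form reads off a single coordinate.\<close>

lemma euler_source:
  assumes "source d s" shows "euler d (simple_root s) y = y s"
proof -
  have s: "s \<in> S" using assms by (simp add: source_def)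
  have "euler d (simple_root s) y = (\<Sum>j\<in>S. y j * euler_coeff d s j)"
    unfolding euler_def simple_root_def using s finite_S by (simp add: if_distrib if_distribR cong: if_cong)
  then show ?thesis
    unfolding euler_coeff_source(1)[OF assms] using s finite_S by (simp add: if_distrib cong: if_cong)
qed

lemma euler_fired:
  assumes "t \<in> S" shows "euler (fire t d) x (\<lambda>i. - simple_root t i) = - x t"
proof -
  have "(\<Sum>j\<in>S. - simple_root t j * euler_coeff (fire t d) i j) = (if i = t then -1 else 0)" for i
  proof -
    have "(\<Sum>j\<in>S. - simple_root t j * euler_coeff (fire t d) i j)
        = (\<Sum>j\<in>S. if j = t then - euler_coeff (fire t d) i t else 0)"
      by (rule sum.cong) (auto simp: simple_root_def)
    also have "\<dots> = - euler_coeff (fire t d) i t" using assms finite_S by simp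
    also have "\<dots> = (if i = t then -1 else 0)"
      by (auto simp: euler_coeff_def fire_def nbr_sym[of t])
    finally show ?thesis .
  qed
  then show ?thesis unfolding euler_def using assms finite_S
    by (simp only:) (simp add: if_distrib cong: if_cong)
qed

text \<open>One value of the Euler form is computed twice: before the firing sequence it is a
  coordinate at the source \<open>s\<close>, and transported along the sequence it is a coordinate
  at the letter \<open>t\<close> fired last.\<close>

lemma firing_duality:
  assumes "fires d (s # V @ [t])"
  shows "word_action (s # V) (simple_root t) s = word_action (t # rev V) (simple_root s) t"
proof -
  define Q where "Q = s # V @ [t]"
  have Q: "fires d Q" "source d s" "s \<in> S" "t \<in> S" "V \<in> lists S"
    using assms fires_lists[OF assms] by (auto simp: Q_def)
  then have QS: "Q \<in> lists S" by (simp add: Q_def)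
  define z where "z = word_action (rev Q) (simple_root s)"
  have z1: "word_action Q z = simple_root s" unfolding z_def by (rule word_action_rev_cancel[OF QS])
  have z2: "z = (\<lambda>i. - word_action (t # rev V) (simple_root s) i)"
    unfolding z_def Q_def using Q
    by (simp add: reflection_simple_root_same word_action_uminus reflection_uminus)
  have t: "word_action Q (\<lambda>i. - simple_root t i) = word_action (s # V) (simple_root t)"
    unfolding Q_def using Q by (simp add: reflection_uminus reflection_simple_root_same)
  have "word_action (s # V) (simple_root t) s = euler d (simple_root s) (word_action (s # V) (simple_root t))"
    using euler_source[OF Q(2)] by simp
  also have "\<dots> = euler (run d Q) z (\<lambda>i. - simple_root t i)"
    using euler_run[OF Q(1), of z "\<lambda>i. - simple_root t i"] z1 t by simp
  also have "\<dots> = - z t" unfolding Q_def using euler_fired[OF Q(4)] by simp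
  finally show ?thesis using z2 by simp
qed

text \<open>The first \<open>t\<close> negates its own simple root. Each letter \<open>n\<close> of
  \<open>N\<close> then adds the nonnegative multiple \<open>- A n t\<close> of a root that is
  positive because the word is reduced.\<close>

lemma mesh_inequality:
  assumes "red (V @ t # N)" "t \<notin> set N" 
  shows "word_action (V @ t # N) (simple_root t) i \<ge> - word_action V (simple_root t) i"
  using assms
proof (induction N rule: rev_induct)
  case Nil
  then have "t \<in> S" by (simp add: red_def)
  then show ?case by (simp add: reflection_simple_root_same word_action_uminus)
next
  case (snoc n N)
  have r: "red (V @ t # N)" "n \<in> S" "nonneg (word_action (V @ t # N) (simple_root n))"
    using red_snoc[of "V @ t # N" n] snoc.prems(1) by auto
  have t: "t \<in> S" "t \<noteq> n" using snoc.prems by (auto simp: red_def)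
  have "word_action ((V @ t # N) @ [n]) (simple_root t)
     = (\<lambda>i. 1 * word_action (V @ t # N) (simple_root t) i + (- A n t) * word_action (V @ t # N) (simple_root n) i)"
    unfolding word_action_append[of "V @ t # N"] word_action_Cons[of n] word_action_Nil
      reflection_simple_root[OF r(2) t(1)] word_action_linear ..
  moreover have "- A n t \<ge> 0" using A_nonpos r t by fastforce
  moreover have "word_action (V @ t # N) (simple_root n) i \<ge> 0" using r(3) by (simp add: nonneg_def)
  moreover have "- word_action V (simple_root t) i \<le> word_action (V @ t # N) (simple_root t) i"
    using snoc r by auto
  ultimately show ?case
    using mult_nonneg_nonneg[of "- A n t" "word_action (V @ t # N) (simple_root n) i"] by simp
qed

text \<open>
  Together with the exchange condition this says that the letter exchanged for a new letter of a
  firing sequence has no predecessor. With \<open>a = - A r s > 0\<close> and \<open>g\<close> the coordinate at \<open>t\<close> of the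
  action of \<open>t # rev V\<close>, duality and the mesh inequality give \<open>g r \<ge> a\<close> and \<open>g r + a * g s = - a\<close>,
  whereas \<open>g s = - 1\<close>.
\<close>

lemma exchanged_letter_no_predecessor:
  assumes f: "fires d (r # s # U @ [t])" and n: "nbr r s" and rd: "red (r # s # U)"
    and act: "word_action U (simple_root t) = simple_root s"
  shows False
proof -
  have S: "r \<in> S" "s \<in> S" "t \<in> S" "U \<in> lists S" using fires_lists[OF f] by auto
  have US: "wp (s # U) = wp (U @ [t])" using wp_conjugate_gen S act by blast
  have rs: "r \<noteq> s" using n by auto
  have "t \<in> set (s # U)"
  proof (rule ccontr)
    assume "t \<notin> set (s # U)"
    then have "word_action (s # U) (simple_root t) t = simple_root t t" by (rule word_action_notin)
    then show False using act \<open>t \<notin> set (s # U)\<close> S by (simp add: reflection_simple_root_same simple_root_def split: if_splits)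
  qed
  \<comment> \<open>Splitting at the last \<open>t\<close> leaves a rest \<open>N\<close> that does
    not touch coordinate \<open>t\<close>, so this coordinate is governed by \<open>V\<close>
    alone.\<close>
  then obtain V N where VN: "s # U = V @ t # N" "t \<notin> set N" using split_list_last by metis
  have VS: "V \<in> lists S" "N \<in> lists S" using S VN(1) by (metis append_in_lists_conv listsE lists.Cons)+
  define a where "a = - A s r"
  have a: "a > 0" using nbr_A_neg n nbr_sym by (simp add: a_def)
  define g where "g x = word_action (t # rev V) x t" for x
  have cancel: "word_action (rev U) (simple_root s) = simple_root t"
    using act word_action_rev_cancel'[OF S(4), of "simple_root t"] by simp
  have revU: "word_action (rev U) x t = g (reflection s x)" for x
  proof -
    have "word_action (rev U) x = word_action (rev (s # U)) (reflection s x)" using S by simp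
    also have "\<dots> = word_action (rev N) (word_action (t # rev V) (reflection s x))"
      unfolding VN by simp
    finally show ?thesis using VN(2) by (simp add: word_action_notin g_def)
  qed
  have gs: "g (simple_root s) = -1"
  proof -
    have "g (reflection s (simple_root s)) = 1"
      using revU[of "simple_root s"] cancel by (simp add: simple_root_def)
    then show ?thesis
      using S by (simp add: g_def reflection_simple_root_same word_action_uminus reflection_uminus)
  qed
  have "fires d (r # V @ [t])" using f VN(1) by (metis append.assoc append_Cons append_Nil fires_append)
  then have "word_action (r # V) (simple_root t) r = g (simple_root r)"
    unfolding g_def by (rule firing_duality)
  moreover have "word_action (r # s # U) (simple_root t) r \<ge> - word_action (r # V) (simple_root t) r"
    using mesh_inequality[of "r # V" t N r] rd VN by simp
  moreover have lhs: "word_action (r # s # U) (simple_root t) r = - a"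
  proof -
    have "word_action (r # s # U) (simple_root t) = (\<lambda>i. - (1 * simple_root s i + (- A r s) * simple_root r i))"
      using act S by (simp add: reflection_simple_root_same reflection_uminus reflection_simple_root)
    then show ?thesis using rs A_sym S by (simp add: simple_root_def a_def)
  qed
  ultimately have gr: "g (simple_root r) \<ge> a" by simp
  have "- a = word_action (t # rev (s # U)) (simple_root r) t"
    using firing_duality[of d r "s # U" t] f lhs by simp
  also have "word_action (t # rev (s # U)) = word_action (rev U)"
  proof (rule word_action_cong)
    have "inv (wp (s # U)) = inv (wp (U @ [t]))" using US by simp
    then have "wp (rev U @ [s]) = wp (t # rev U)" using S wp_rev[of "s # U"] wp_rev[of "U @ [t]"] by simp
    then show "wp (t # rev (s # U)) = wp (rev U)"
      using S by simp
  qed (use S in auto)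
  also have "word_action (rev U) (simple_root r) t = g (simple_root r) + a * g (simple_root s)"
    unfolding revU reflection_simple_root[OF S(2,1)] g_def a_def
    using word_action_linear[of "t # rev V" 1 "simple_root r" "- A s r" "simple_root s"] by simp
  finally show False using gr gs a by simp
qed

section \<open>Words up to commutations, and exchange in firing sequences\<close>

abbreviation eqc :: "'a list \<Rightarrow> 'a list \<Rightarrow> bool" where
  "eqc \<equiv> equal_up_to_commutations W"

lemma commutation_step_sym: "commutation_step W u v \<Longrightarrow> commutation_step W v u"
  unfolding commutation_step_def using commuting_sym by blast

lemma eqc_refl [simp]: "eqc u u" by (simp add: equal_up_to_commutations_def)

lemma eqc_trans: "eqc u v \<Longrightarrow> eqc v w \<Longrightarrow> eqc u w"
  by (simp add: equal_up_to_commutations_def)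

lemma eqc_sym: "eqc u v \<Longrightarrow> eqc v u"
  unfolding equal_up_to_commutations_def
  by (metis commutation_step_sym symp_rtranclp sympD sympI)

lemma eqc_invariant:
  assumes "eqc u v" "\<And>xs ys s t. commuting W s t \<Longrightarrow> P (xs @ [s, t] @ ys) \<Longrightarrow> P (xs @ [t, s] @ ys)" "P u"
  shows "P v"
  using assms(1) unfolding equal_up_to_commutations_def
  by (induction rule: rtranclp_induct) (use assms(2,3) in \<open>auto simp: commutation_step_def\<close>)

lemma eqc_context: "eqc u v \<Longrightarrow> eqc (a @ u @ b) (a @ v @ b)"
proof (rule eqc_invariant[of u v "\<lambda>z. eqc (a @ u @ b) (a @ z @ b)"])
  fix xs ys s t assume *: "commuting W s t" "eqc (a @ u @ b) (a @ (xs @ [s, t] @ ys) @ b)"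
  have "commutation_step W ((a @ xs) @ [s, t] @ (ys @ b)) ((a @ xs) @ [t, s] @ (ys @ b))"
    unfolding commutation_step_def using *(1) by blast
  then show "eqc (a @ u @ b) (a @ (xs @ [t, s] @ ys) @ b)"
    using *(2) unfolding equal_up_to_commutations_def by simp
qed auto

lemma eqc_mset: "eqc u v \<Longrightarrow> mset u = mset v"
  by (rule eqc_invariant[of u v "\<lambda>z. mset u = mset z"]) auto

lemma eqc_lists: "eqc u v \<Longrightarrow> u \<in> lists S \<longleftrightarrow> v \<in> lists S"
  using eqc_mset mset_eq_setD by (metis in_lists_conv_set)

lemma eqc_move:
  assumes "\<And>x. x \<in> set X \<Longrightarrow> commuting W s x"
  shows "eqc (X @ s # Y) (s # X @ Y)"
  using assms
proof (induction X)
  case (Cons x X)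
  have "eqc ([x] @ (X @ s # Y) @ []) ([x] @ (s # X @ Y) @ [])" using Cons by (intro eqc_context) auto
  moreover have "commutation_step W ([] @ [x, s] @ X @ Y) ([] @ [s, x] @ X @ Y)"
    unfolding commutation_step_def using Cons.prems[of x] commuting_sym by (metis list.set_intros(1))
  then have "eqc ([x] @ (s # X @ Y) @ []) (s # (x # X) @ Y)"
    unfolding equal_up_to_commutations_def by auto
  ultimately show ?case using eqc_trans by auto
qed simp

lemma eqc_wp: assumes "eqc u v" "u \<in> lists S" shows "wp v = wp u"
proof -
  have "v \<in> lists S \<and> wp v = wp u"
  proof (rule eqc_invariant[OF assms(1)])
    fix xs ys s t assume *: "commuting W s t" "xs @ [s, t] @ ys \<in> lists S \<and> wp (xs @ [s, t] @ ys) = wp u"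
    have "wp ([s, t] @ ys) = wp ([t, s] @ ys)"
      using * by (intro wp_append_cong) (auto simp: commuting_def)
    then have "wp (xs @ [s, t] @ ys) = wp (xs @ [t, s] @ ys)"
      using *(2) wp_append_cong[of xs "[s, t] @ ys" xs "[t, s] @ ys"] by simp
    then show "xs @ [t, s] @ ys \<in> lists S \<and> wp (xs @ [t, s] @ ys) = wp u" using * by auto
  qed (use assms in auto)
  then show ?thesis by simp
qed

lemma eqc_red: "eqc u v \<Longrightarrow> red u \<Longrightarrow> red v"
  using eqc_wp eqc_lists eqc_mset by (metis mset_eq_length red_def)

lemma fire_commute: "\<not> nbr s t \<Longrightarrow> fire s (fire t d) = fire t (fire s d)"
  using nbr_sym[of s t] by (intro ext) (auto simp: fire_def)

lemma source_fire:
  assumes "\<not> nbr s t" "s \<noteq> t"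
  shows "source (fire t d) s \<longleftrightarrow> source d s"
  using assms by (auto simp: source_def fire_def nbr_sym[of t s])

lemma eqc_fires: assumes "eqc u v" "fires d u" shows "fires d v"
proof (rule eqc_invariant[OF assms(1)])
  fix xs ys s t assume *: "commuting W s t" "fires d (xs @ [s, t] @ ys)"
  have n: "\<not> nbr s t" "\<not> nbr t s" using * by (auto simp: nbr_def commuting_sym)
  show "fires d (xs @ [t, s] @ ys)"
  proof (cases "s = t")
    case False
    then show ?thesis using * source_fire[OF n(1)] source_fire[OF n(2)] fire_commute[OF n(1)] by auto
  qed (use * in simp)
qed (use assms in auto)

text \<open>In a firing sequence the exchanged letter can be brought to the front by commutations.
  This is what allows it to leave the reduced factor on the left while \<open>t\<close> enters on
  the right.\<close>

lemma fires_exchange: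
  assumes f: "fires d (P @ [t])" and rd: "red P" and np: "nonpos (word_action P (simple_root t))"
  obtains X s Y where "P = X @ s # Y" "\<And>x. x \<in> set X \<Longrightarrow> commuting W s x"
    "wp (s # X @ Y) = wp (X @ Y @ [t])" "s \<in> S"
proof -
  have S: "P \<in> lists S" "t \<in> S" using fires_lists[OF f] by auto
  obtain X s Y where e: "P = X @ s # Y" "word_action Y (simple_root t) = simple_root s"
      "wp (s # Y) = wp (Y @ [t])" using exchange[OF S np] by blast
  have XY: "X \<in> lists S" "Y \<in> lists S" "s \<in> S" using S e by auto
  have all: "x \<noteq> s \<and> \<not> nbr s x" if "x \<in> set X" for x
  proof (rule ccontr)
    assume "\<not> ?thesis"
    then have "\<exists>x\<in>set X. x = s \<or> nbr s x" using that by blast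
    \<comment> \<open>For the last such letter \<open>r\<close>, everything between \<open>r\<close>
      and \<open>s\<close> commutes with \<open>s\<close>, so \<open>s\<close> may be moved next to
      \<open>r\<close>. If \<open>r = s\<close>, the two cancel in a reduced word; a neighbour
      \<open>r\<close> is excluded by \<open>exchanged_letter_no_predecessor\<close>.\<close>
    then obtain X1 r X2 where X: "X = X1 @ r # X2" "r = s \<or> nbr s r" "\<forall>x\<in>set X2. \<not> (x = s \<or> nbr s x)"
      by (rule split_list_last_propE)
    have XS: "X1 \<in> lists S" "r \<in> S" "X2 \<in> lists S" using X XY by auto
    have X2: "commuting W s x" "commuting W x s" "x \<in> S" "x \<noteq> s" if "x \<in> set X2" for x
      using that X(3) XS XY not_nbr_commuting commuting_sym by auto
    have eq: "eqc P (X1 @ r # s # X2 @ Y)"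
      using eqc_context[OF eqc_move[of X2 s Y], of "X1 @ [r]" "[]"] X2 by (simp add: e X)
    then have eqt: "eqc (P @ [t]) (X1 @ r # s # (X2 @ Y) @ [t])" 
      using eqc_context[OF eq, of "[]" "[t]"] by simp
    have rd': "red (X1 @ r # s # X2 @ Y)" using eqc_red[OF eq rd] .
    show False
    proof (cases "r = s")
      case True
      have "wp (X1 @ r # s # X2 @ Y) = wp (X1 @ X2 @ Y)" using True XS XY by (simp add: wp_append)
      then have "length (X1 @ r # s # X2 @ Y) \<le> length (X1 @ X2 @ Y)"
        using red_le[OF rd', of "X1 @ X2 @ Y"] XS XY by simp
      then show False by simp
    next
      case False
      then have "nbr r s" using X(2) nbr_sym by blast
      moreover have "fires (run d X1) (r # s # (X2 @ Y) @ [t])"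
        using eqc_fires[OF eqt f] by simp
      moreover have "red (r # s # X2 @ Y)" using rd' by (rule red_append)
      moreover have "word_action (X2 @ Y) (simple_root t) = simple_root s"
      proof -
        have "word_action X2 (simple_root s) = simple_root s"
          using X2 XY by (induction X2) (auto simp: reflection_fix_commuting)
        then show ?thesis using e by simp
      qed
      ultimately show False using exchanged_letter_no_predecessor by blast
    qed
  qed
  then have c: "commuting W s x" if "x \<in> set X" for x
    using that XY not_nbr_commuting by auto
  have "wp (s # X @ Y) = wp (X @ s # Y)"
    using eqc_wp[OF eqc_move[of X s Y]] c XY by simp
  also have "\<dots> = wp (X @ Y @ [t])"
    using XY S e(3) by (intro wp_append_cong) auto
  finally show ?thesis using that e c XY by blast
qed

text \<open>As long as \<open>s\<close> has not been fired, its edges point away from it, so no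
  neighbour can become a source.\<close>

lemma fires_source_first:
  assumes "fires d (X @ s # Y)" "source d s" "s \<notin> set X" "x \<in> set X"
  shows "\<not> nbr s x"
  using assms
proof (induction X arbitrary: d)
  case (Cons y X)
  have n: "\<not> nbr s y" 
    using Cons.prems(1,2) nbr_sym by (auto simp: source_def)
  moreover have "source (fire y d) s" using source_fire[OF n] Cons.prems by auto
  ultimately show ?case using Cons.IH[of "fire y d"] Cons.prems by auto
qed simp

text \<open>The abelian property of firing: the first letter of \<open>u\<close> is a source, so by
  \<open>fires_source_first\<close> its first occurrence in \<open>v\<close> commutes to the front.
  Multiplicities thus determine a firing sequence up to commutations.\<close>

lemma fires_prefix:
  assumes "fires d u" "fires d v" "mset u \<subseteq># mset v"
  shows "\<exists>R. eqc v (u @ R)"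
  using assms
proof (induction u arbitrary: d v)
  case Nil
  then show ?case by (intro exI[of _ v]) simp
next
  case (Cons s u)
  have "s \<in> set v" using Cons.prems(3) by (metis insert_subset_eq_iff mset.simps(2) set_mset_mset)
  then obtain X Y where v: "v = X @ s # Y" "s \<notin> set X" using split_list_first by metis
  have "source d s" using Cons.prems by simp
  then have "\<not> nbr s x" if "x \<in> set X" for x
    using fires_source_first Cons.prems(2) v that by metis
  then have "commuting W s x" if "x \<in> set X" for x
    using that fires_lists[OF Cons.prems(2)] v not_nbr_commuting by auto
  then have e: "eqc v (s # X @ Y)" unfolding v using eqc_move by blast
  then have "fires (fire s d) (X @ Y)" using eqc_fires[OF e Cons.prems(2)] by simp
  moreover have "mset u \<subseteq># mset (X @ Y)" using Cons.prems(3) v by (simp add: mset_subset_eq_insertD)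
  ultimately obtain R where "eqc (X @ Y) (u @ R)" using Cons.IH[of "fire s d" "X @ Y"] Cons.prems(1) by auto
  then have "eqc ([s] @ (X @ Y) @ []) ([s] @ (u @ R) @ [])" by (rule eqc_context)
  then show ?case using eqc_trans[OF e] by auto
qed

lemma fires_same_mset:
  assumes "fires d u" "fires d v" "mset u = mset v" shows "eqc v u"
proof -
  obtain R where R: "eqc v (u @ R)" using fires_prefix[OF assms(1,2)] assms(3) by auto
  then have "R = []" using eqc_mset[OF R] assms(3) by simp
  then show ?thesis using R by simp
qed

end

section \<open>Reduced words for the longest element inside powers of a Coxeter word\<close>

abbreviation pr :: "'a \<Rightarrow> 'a \<Rightarrow> 'a list \<Rightarrow> 'a list" where
  "pr s t \<equiv> filter (\<lambda>x. x = s \<or> x = t)"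

definition is_alternating :: "'a \<Rightarrow> 'a \<Rightarrow> 'a list \<Rightarrow> bool" where
  "is_alternating s t xs \<longleftrightarrow> xs = alternating s t (length xs)"

lemma is_alternating_Nil [simp]: "is_alternating s t []"
  and is_alternating_Cons [simp]: "is_alternating s t (x # xs) \<longleftrightarrow> x = s \<and> is_alternating t s xs"
  by (auto simp: is_alternating_def)

lemma is_alternating_append:
  "is_alternating s t (xs @ ys) \<longleftrightarrow> is_alternating s t xs \<and>
    (if even (length xs) then is_alternating s t ys else is_alternating t s ys)"
  by (induction xs arbitrary: s t) auto

lemma is_alternating_alternating [simp]: "is_alternating s t (alternating s t n)"
  by (simp add: is_alternating_def)

lemma is_alternating_distinct_adj: "s \<noteq> t \<Longrightarrow> is_alternating s t xs \<Longrightarrow> distinct_adj xs"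
proof (induction xs arbitrary: s t)
  case (Cons x xs)
  then have "x = s" "is_alternating t s xs" "distinct_adj xs" using Cons.IH[of t s] by auto
  then show ?case using Cons.prems(1) by (cases xs) auto
qed simp

lemma distinct_adj_is_alternating:
  "distinct_adj xs \<Longrightarrow> set xs \<subseteq> {s, t} \<Longrightarrow> xs = [] \<or> hd xs = s \<Longrightarrow> is_alternating s t xs"
proof (induction xs arbitrary: s t)
  case (Cons x xs)
  then show ?case by (cases xs) auto
qed simp

lemma count_is_alternating:
  assumes "s \<noteq> t" "is_alternating s t xs"
  shows "count (mset xs) s = (length xs + 1) div 2" "count (mset xs) t = length xs div 2"
proof -
  have "count (mset (alternating s t n)) s = (n + 1) div 2 \<and> count (mset (alternating s t n)) t = n div 2"
    if "s \<noteq> t" for n and s t :: 'a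
    using that by (induction n arbitrary: s t) auto
  then show "count (mset xs) s = (length xs + 1) div 2" "count (mset xs) t = length xs div 2"
    using assms unfolding is_alternating_def by metis+
qed

lemma pr_sym: "pr s t xs = pr t s xs"
  by (rule filter_cong) auto

lemma count_pr: "count (mset (pr s t xs)) s = count (mset xs) s" "count (mset (pr s t xs)) t = count (mset xs) t"
  by (induction xs) auto

context coxeter_presentation begin

definition oriented :: "('a \<Rightarrow> 'a \<Rightarrow> bool) \<Rightarrow> bool" where
  "oriented d \<longleftrightarrow> (\<forall>s t. nbr s t \<longrightarrow> (d s t \<longleftrightarrow> \<not> d t s))"

lemma oriented_fire: "oriented d \<Longrightarrow> oriented (fire s d)"
  unfolding oriented_def
proof (intro allI impI)
  fix x y assume d: "\<forall>s t. nbr s t \<longrightarrow> d s t = (\<not> d t s)" and n: "nbr x y"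
  then have "nbr y x" "x \<noteq> y" using nbr_sym by auto
  then show "fire s d x y = (\<not> fire s d y x)" using n d[rule_format, OF n] by (auto simp: fire_def)
qed

text \<open>A firing only concerns the edges at its letter, and an edge can be flipped only from its
  current tail. This is the link between firing sequences and the intervening neighbors
  property.\<close>

lemma fires_iff_alternating:
  assumes "oriented d"
  shows "fires d Q \<longleftrightarrow> Q \<in> lists S \<and> (\<forall>s t. nbr s t \<and> d s t \<longrightarrow> is_alternating s t (pr s t Q))"
  using assms
proof (induction Q arbitrary: d)
  case (Cons q Q)
  note IH = Cons.IH[OF oriented_fire[OF Cons.prems], of q]
  show ?case
  proof
    assume f: "fires d (q # Q)"
    then have src: "source d q" and f': "fires (fire q d) Q" by auto
    have "is_alternating s t (pr s t (q # Q))" if st: "nbr s t" "d s t" for s t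
    proof -
      have *: "is_alternating a b (pr a b Q)" if "nbr a b" "fire q d a b" for a b
        using f' IH that by blast
      show ?thesis
      proof (cases "q = s")
        case True
        then have "fire q d t s" using st nbr_sym[of s t] by (auto simp: fire_def)
        then show ?thesis using *[of t s] st nbr_sym[of s t] True pr_sym[of s t Q] by auto
      next
        case False
        have "q \<noteq> t" using src st nbr_sym[of s t] unfolding source_def by blast
        then show ?thesis using False *[of s t] st by (auto simp: fire_def)
      qed
    qed
    then show "q # Q \<in> lists S \<and> (\<forall>s t. nbr s t \<and> d s t \<longrightarrow> is_alternating s t (pr s t (q # Q)))"
      using fires_lists[OF f] by blast
  next
    assume a: "q # Q \<in> lists S \<and> (\<forall>s t. nbr s t \<and> d s t \<longrightarrow> is_alternating s t (pr s t (q # Q)))"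
    have src: "source d q" unfolding source_def
    proof (intro conjI allI impI)
      fix x assume n: "nbr q x"
      show d: "d q x"
      proof (rule ccontr)
        assume "\<not> d q x"
        then have "nbr x q \<and> d x q" using n Cons.prems nbr_sym[of q x] unfolding oriented_def by blast
        then have "is_alternating x q (pr x q (q # Q))" using a by blast
        then show False using n by auto
      qed
      then show "\<not> d x q" using n Cons.prems unfolding oriented_def by blast
    qed (use a in auto)
    have "is_alternating s t (pr s t Q)" if st: "nbr s t" "fire q d s t" for s t
    proof -
      have "q \<noteq> s" using st by (auto simp: fire_def)
      show ?thesis
      proof (cases "q = t")
        case True
        then have "d t s" using src st nbr_sym[of s t] by (auto simp: source_def)
        then have "is_alternating t s (pr t s (q # Q))" using a st nbr_sym[of s t] by blast
        then show ?thesis using True pr_sym[of s t Q] by simp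
      next
        case False
        then have "d s t" using st \<open>q \<noteq> s\<close> by (auto simp: fire_def)
        then have "is_alternating s t (pr s t (q # Q))" using a st by blast
        then show ?thesis using False \<open>q \<noteq> s\<close> by simp
      qed
    qed
    then show "fires d (q # Q)" using src IH a by auto
  qed
qed simp

definition word_orientation :: "'a list \<Rightarrow> 'a \<Rightarrow> 'a \<Rightarrow> bool" where
  "word_orientation c s t \<longleftrightarrow> hd (pr s t c) = s"

abbreviation power_word :: "'a list \<Rightarrow> nat \<Rightarrow> 'a list" where
  "power_word c n \<equiv> concat (replicate n c)"

end

locale coxeter_word = coxeter_presentation +
  fixes c :: "'a list"
  assumes distinct_c: "distinct c" and set_c: "set c = S"
begin

abbreviation dc :: "'a \<Rightarrow> 'a \<Rightarrow> bool" where "dc \<equiv> word_orientation c"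

lemma pr_c:
  assumes "nbr s t" shows "pr s t c = [s, t] \<or> pr s t c = [t, s]"
proof -
  have st: "s \<in> S" "t \<in> S" "s \<noteq> t" using assms by (auto simp: nbr_def)
  have set: "set (pr s t c) = {s, t}" and d: "distinct (pr s t c)" using st set_c distinct_c by auto
  then have "length (pr s t c) = 2" using distinct_card[OF d] st by simp
  then obtain a b where ab: "pr s t c = [a, b]" by (auto simp: length_Suc_conv numeral_2_eq_2)
  then show ?thesis using set d by (auto simp: doubleton_eq_iff)
qed

lemma dc_pr: "nbr s t \<Longrightarrow> dc s t \<longleftrightarrow> pr s t c = [s, t]"
  using pr_c[of s t] by (auto simp: word_orientation_def nbr_def)

lemma oriented_dc: "oriented dc"
  unfolding oriented_def
proof (intro allI impI)
  fix s t assume n: "nbr s t"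
  then show "dc s t \<longleftrightarrow> \<not> dc t s"
    using pr_c[OF n] nbr_sym[of s t] by (auto simp: word_orientation_def pr_sym[of t s] nbr_def)
qed

lemma pr_power_word: "nbr s t \<Longrightarrow> dc s t \<Longrightarrow> pr s t (power_word c n) = alternating s t (2 * n)"
  using dc_pr by (simp add: filter_concat flip: concat_replicate_pair)

lemma power_word_lists: "power_word c n \<in> lists S"
  using set_c by (auto simp: in_lists_conv_set)

text \<open>Each copy of \<open>c\<close> flips every edge exactly twice, so the orientation is
  unchanged after a power of \<open>c\<close>.\<close>

lemma fires_power_word_append: "fires dc (power_word c n @ Q) \<longleftrightarrow> fires dc Q"
  unfolding fires_iff_alternating[OF oriented_dc]
  using power_word_lists[of n] by (auto simp: pr_power_word is_alternating_append)

lemma fires_power_word: "fires dc (power_word c n)"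
  using fires_power_word_append[of n "[]"] by simp

lemma count_power_word: "count (mset (power_word c n)) s = (if s \<in> S then n else 0)"
proof (induction n)
  case (Suc n)
  then show ?case using distinct_count_atmost_1[of c] distinct_c set_c by simp
qed simp

section \<open>Rotating a reduced factor along a firing sequence\<close>

lemma fires_extend:
  assumes "fires dc Q"
  obtains R N where "eqc (power_word c N) (Q @ R)" "S \<subseteq> set R"
proof -
  \<comment> \<open>One more than the length of \<open>Q\<close>, so that every multiplicity in
    \<open>Q\<close> is exceeded and each generator is left over for \<open>R\<close>.\<close>
  define N where "N = Suc (length Q)"
  have le: "count (mset Q) s < N" for s
    using count_le_replicate_mset_subset_eq[of "count (mset Q) s" "mset Q" s] size_mset_mono[of _ "mset Q"]
    by (metis N_def le_imp_less_Suc order_refl size_mset size_replicate_mset)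
  have "mset Q \<subseteq># mset (power_word c N)"
  proof (rule mset_subset_eqI)
    fix s
    show "count (mset Q) s \<le> count (mset (power_word c N)) s"
      using fires_lists[OF assms] le[of s] by (cases "s \<in> S") (auto simp: count_power_word in_lists_conv_set)
  qed
  then obtain R where R: "eqc (power_word c N) (Q @ R)"
    using fires_prefix[OF assms fires_power_word] by blast
  have "s \<in> set R" if "s \<in> S" for s
  proof -
    have "count (mset Q) s + count (mset R) s = N"
      using eqc_mset[OF R] count_power_word[of N s] that by (metis count_union mset_append)
    then show ?thesis using le[of s] by (metis add_0_right count_mset_0_iff less_irrefl)
  qed
  then show ?thesis using that R by blast
qed

text \<open>The exchanged letter passes from \<open>P\<close> to \<open>B\<close>, and
  \<open>t\<close> takes its place at the end. The last equation identifies \<open>s\<close> as the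
  conjugate of \<open>t\<close> by the element of \<open>P\<close>.\<close>

lemma rotate_step:
  assumes "fires d (B @ P @ [t])" "red P" "nonpos (word_action P (simple_root t))"
  obtains s P' where "eqc (B @ P @ [t]) ((B @ [s]) @ P')" "red P'" "length P' = length P" "wp P' = wp P"
    "s \<in> S" "s \<otimes> wp P = wp P \<otimes> t"
proof -
  have f: "fires (run d B) (P @ [t])" using assms by simp
  obtain X s Y where e: "P = X @ s # Y" "\<And>x. x \<in> set X \<Longrightarrow> commuting W s x"
    "wp (s # X @ Y) = wp (X @ Y @ [t])" "s \<in> S"
    using fires_exchange[OF f assms(2,3)] by blast
  have S: "X \<in> lists S" "Y \<in> lists S" "t \<in> S" using fires_lists[OF f] e by auto
  have q: "eqc P (s # X @ Y)" using eqc_move e by simp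
  have w: "wp (s # X @ Y) = wp P" using eqc_wp[OF q red_lists[OF assms(2)]] .
  show ?thesis
  proof
    show "eqc (B @ P @ [t]) ((B @ [s]) @ (X @ Y @ [t]))" using eqc_context[OF q, of B "[t]"] by simp
    show wP: "wp (X @ Y @ [t]) = wp P" using e w by simp
    show l: "length (X @ Y @ [t]) = length P" using e by simp
    show "red (X @ Y @ [t])"
      using wP l assms(2) S by (simp add: red_def del: append_assoc)
    show "s \<otimes> wp P = wp P \<otimes> t"
    proof -
      have "s \<otimes> wp P = wp (X @ Y)" using w[symmetric] S e(4) by (simp add: wp_append)
      moreover have "wp P \<otimes> t = wp (X @ Y)" using wP[symmetric] S by (simp add: wp_append m_assoc)
      ultimately show ?thesis by simp
    qed
  qed (rule e)
qed

text \<open>The letters of \<open>R\<close> are absorbed one at a time. Each is a descent of the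
  current factor, as otherwise it would prolong it beyond the maximum; since rotation keeps the
  element, all are descents of \<open>P\<close> itself.\<close>

lemma maximal_factor_descents:
  assumes f: "fires dc (B @ P)" and rd: "red P"
    and max: "\<And>B' P'. fires dc (B' @ P') \<Longrightarrow> red P' \<Longrightarrow> length P' \<le> length P"
  shows "fires dc (B @ P @ R) \<Longrightarrow>
    \<exists>B' P'. eqc (B @ P @ R) (B' @ P') \<and> red P' \<and> length P' = length P \<and> wp P' = wp P \<and>
      (\<forall>t\<in>set R. nonpos (word_action P (simple_root t)))"
proof (induction R rule: rev_induct)
  case Nil
  then show ?case using rd by (intro exI[of _ B] exI[of _ P]) simp
next
  case (snoc t R)
  then obtain B' P' where IH: "eqc (B @ P @ R) (B' @ P')" "red P'" "length P' = length P" "wp P' = wp P"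
      "\<forall>t\<in>set R. nonpos (word_action P (simple_root t))" by auto
  have e: "eqc (B @ P @ R @ [t]) (B' @ P' @ [t])" using eqc_context[OF IH(1), of "[]" "[t]"] by simp
  have f': "fires dc (B' @ P' @ [t])" using eqc_fires[OF e] snoc.prems by simp
  have S: "t \<in> S" "P' \<in> lists S" "P \<in> lists S" using fires_lists[OF f'] red_lists rd by auto
  have np: "nonpos (word_action P' (simple_root t))"
  proof (rule ccontr)
    assume "\<not> ?thesis"
    then have "red (P' @ [t])" using nonneg_or_nonpos S red_snoc IH by blast
    then show False using max[of B' "P' @ [t]"] f' IH(3) by simp
  qed
  obtain s P'' where "eqc (B' @ P' @ [t]) ((B' @ [s]) @ P'')" "red P''" "length P'' = length P'" "wp P'' = wp P'"
    using rotate_step[OF f' IH(2) np] by metis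
  moreover have "nonpos (word_action P (simple_root t))" using np word_action_cong[OF S(2,3) IH(4)] by simp
  ultimately show ?case using IH eqc_trans[OF e]
    by (intro exI[of _ "B' @ [s]"] exI[of _ P'']) auto
qed

definition ends_in_w0 :: "'a list \<Rightarrow> 'a list \<Rightarrow> bool" where
  "ends_in_w0 B P \<longleftrightarrow> fires dc (B @ P) \<and> red P \<and> wp P = w0"

lemma ends_in_w0_exists: "\<exists>B P. ends_in_w0 B P"
proof -
  obtain n where n: "\<forall>u\<in>lists S. len u \<le> n" using len_bounded by blast
  define G where "G = (\<lambda>(B, P). fires dc (B @ P) \<and> red P)"
  have "G ([], [])" by (simp add: G_def red_def len_wp_one)
  moreover have "\<forall>x. G x \<longrightarrow> length (snd x) < Suc n"
    using n by (auto simp: G_def red_def less_Suc_eq_le)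
  ultimately obtain x where "G x \<and> (\<forall>y. G y \<longrightarrow> length (snd y) \<le> length (snd x))"
    using ex_has_greatest_nat[of G "([], [])" "\<lambda>x. length (snd x)" "Suc n"] by blast
  then obtain B P where BP: "fires dc (B @ P)" "red P"
    "\<And>B' P'. fires dc (B' @ P') \<Longrightarrow> red P' \<Longrightarrow> length P' \<le> length P"
    by (cases x) (force simp: G_def)
  \<comment> \<open>A continuation containing every generator turns the previous lemma into the
    statement that all generators are descents of \<open>P\<close>.\<close>
  obtain R N where R: "eqc (power_word c N) ((B @ P) @ R)" "S \<subseteq> set R" using fires_extend[OF BP(1)] by blast
  have "fires dc (B @ P @ R)" using eqc_fires[OF R(1) fires_power_word] by simp
  then have "\<forall>t\<in>set R. nonpos (word_action P (simple_root t))"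
    using maximal_factor_descents[OF BP(1,2), of R] BP(3) by blast
  then have "full_descent P" using R(2) red_lists[OF BP(2)] by (auto simp: full_descent_def)
  then have "ends_in_w0 B P" using BP(1,2) full_descent_longest unfolding ends_in_w0_def by blast
  then show ?thesis by blast
qed

text \<open>All generators are descents of \<open>w0\<close>, so rotation applies to any
  \<open>t\<close>; its equation \<open>s w0 = w0 t\<close> says that the expelled letter is
  \<open>\<psi> t\<close>.\<close>

lemma ends_in_w0_step:
  assumes "ends_in_w0 B P" "fires dc (B @ P @ [t])"
  obtains P' where "ends_in_w0 (B @ [\<psi> t]) P'" "eqc (B @ P @ [t]) ((B @ [\<psi> t]) @ P')"
proof -
  have P: "red P" "wp P = w0" "P \<in> lists S" and t: "t \<in> S"
    using assms(1) fires_lists[OF assms(2)] by (auto simp: ends_in_w0_def)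
  have "full_descent P" using full_descent_iff P by blast
  then have "nonpos (word_action P (simple_root t))" using t by (simp add: full_descent_def)
  then obtain s P' where e: "eqc (B @ P @ [t]) ((B @ [s]) @ P')" "red P'" "wp P' = wp P" "s \<in> S" "s \<otimes> wp P = wp P \<otimes> t"
    using rotate_step[OF assms(2) P(1)] by metis
  have "s = s \<otimes> w0 \<otimes> inv w0" using e(4) by (simp add: m_assoc)
  then have "s = \<psi> t" using e(5) P(2) t by (simp add: inv_w0 psi_eq)
  moreover have "fires dc ((B @ [s]) @ P')" using eqc_fires[OF e(1) assms(2)] .
  ultimately show ?thesis using that e P by (auto simp: ends_in_w0_def)
qed

lemma ends_in_w0_run:
  "ends_in_w0 B P \<Longrightarrow> fires dc (B @ P @ R) \<Longrightarrow>
    \<exists>P'. ends_in_w0 (B @ map \<psi> R) P' \<and> eqc (B @ P @ R) (B @ map \<psi> R @ P')"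
proof (induction R rule: rev_induct)
  case Nil
  then show ?case by (intro exI[of _ P]) simp
next
  case (snoc t R)
  then obtain P' where P': "ends_in_w0 (B @ map \<psi> R) P'" "eqc (B @ P @ R) (B @ map \<psi> R @ P')" by auto
  have e: "eqc (B @ P @ R @ [t]) ((B @ map \<psi> R) @ P' @ [t])"
    using eqc_context[OF P'(2), of "[]" "[t]"] by simp
  have "fires dc ((B @ map \<psi> R) @ P' @ [t])" using eqc_fires[OF e] snoc.prems by simp
  then obtain P'' where "ends_in_w0 ((B @ map \<psi> R) @ [\<psi> t]) P''"
    "eqc ((B @ map \<psi> R) @ P' @ [t]) (((B @ map \<psi> R) @ [\<psi> t]) @ P'')"
    using ends_in_w0_step[OF P'(1)] by metis
  then show ?case using eqc_trans[OF e] by (intro exI[of _ P'']) auto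
qed

text \<open>Rotating along a long continuation \<open>R\<close> puts the image of \<open>R\<close>
  under \<open>\<psi>\<close> right after \<open>B\<close>. There \<open>s\<close> is a source, so
  it commutes with what precedes it; applying \<open>\<psi>\<close> again, \<open>\<psi> s\<close>
  commutes to the front of \<open>R\<close>.\<close>

lemma ends_in_w0_next:
  assumes "ends_in_w0 B P" "fires dc (B @ [s])"
  shows "fires dc (B @ P @ [\<psi> s])"
proof -
  have f: "fires dc (B @ P)" using assms by (simp add: ends_in_w0_def)
  have s: "s \<in> S" using fires_lists[OF assms(2)] by simp
  obtain R N where R: "eqc (power_word c N) ((B @ P) @ R)" "S \<subseteq> set R" using fires_extend[OF f] by blast
  then have fR: "fires dc (B @ P @ R)" using eqc_fires[OF R(1) fires_power_word] by simp
  have RS: "R \<in> lists S" using fires_lists[OF fR] by simp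
  define t where "t = \<psi> s"
  have t: "t \<in> S" "\<psi> t = s" using psi_in_S psi_involution s by (auto simp: t_def)
  then obtain X Y where XY: "R = X @ t # Y" "t \<notin> set X" using R(2) split_list_first by (metis subset_iff)
  have XS: "set X \<subseteq> S" using RS XY by auto
  obtain P' where "ends_in_w0 (B @ map \<psi> R) P'" using ends_in_w0_run[OF assms(1) fR] by blast
  then have "fires (run dc B) (map \<psi> X @ s # map \<psi> Y @ P')" by (auto simp: ends_in_w0_def XY t)
  moreover have "source (run dc B) s" using assms(2) by simp
  moreover have "s \<notin> set (map \<psi> X)"
  proof
    assume "s \<in> set (map \<psi> X)"
    then obtain x where "x \<in> set X" "\<psi> x = \<psi> t" using t by auto
    then show False using inj_psi XS t XY(2) by (metis inj_onD subset_iff)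
  qed
  ultimately have "\<not> nbr s (\<psi> x)" if "x \<in> set X" for x
    using fires_source_first that by (metis image_eqI list.set_map)
  then have "commuting W t x" if "x \<in> set X" for x
    using that XS s t psi_in_S not_nbr_commuting commuting_psi[of t x] by (metis subset_iff)
  then have "eqc (X @ t # Y) (t # X @ Y)" by (rule eqc_move)
  from eqc_context[OF this, of "B @ P" "[]"] have "eqc (B @ P @ R) ((B @ P @ [t]) @ X @ Y)" using XY by simp
  from eqc_fires[OF this fR] show ?thesis unfolding t_def by (simp del: append_assoc)
qed

text \<open>Once the letters added so far are rotated through, they stand after \<open>B\<close> as
  \<open>R\<close> again, because \<open>\<psi>\<close> is an involution; then
  \<open>ends_in_w0_next\<close> adds one more letter.\<close>

lemma ends_in_w0_follow:
  "ends_in_w0 B P \<Longrightarrow> fires dc (B @ R) \<Longrightarrow> fires dc (B @ P @ map \<psi> R)"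
proof (induction R rule: rev_induct)
  case Nil
  then show ?case by (simp add: ends_in_w0_def)
next
  case (snoc s R)
  then have f: "fires dc (B @ P @ map \<psi> R)" by simp
  have "R \<in> lists S" using fires_lists[OF snoc.prems(2)] by simp
  then have R: "map \<psi> (map \<psi> R) = R" by (induction R) (auto simp: psi_involution)
  obtain P' where P': "ends_in_w0 (B @ R) P'" "eqc (B @ P @ map \<psi> R) (B @ R @ P')"
    using ends_in_w0_run[OF snoc.prems(1) f] unfolding R by blast
  have "fires dc ((B @ R) @ P' @ [\<psi> s])" 
    using ends_in_w0_next[OF P'(1), of s] snoc.prems(2) by (simp del: fires_append)
  moreover have "eqc ((B @ R) @ P' @ [\<psi> s]) (B @ P @ map \<psi> R @ [\<psi> s])"
    using eqc_context[OF eqc_sym[OF P'(2)], of "[]" "[\<psi> s]"] by simp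
  ultimately show ?case using eqc_fires by (metis list.simps(8,9) map_append)
qed

lemma w0_firing_word:
  obtains P where "fires dc P" "red P" "wp P = w0" "\<And>R. fires dc R \<Longrightarrow> fires dc (P @ map \<psi> R)"
proof -
  obtain B P where g: "ends_in_w0 B P" using ends_in_w0_exists by blast
  have fB: "fires dc B" using g by (simp add: ends_in_w0_def)
  obtain R N where R: "eqc (power_word c N) (B @ R)" using fires_extend[OF fB] by blast
  \<comment> \<open>\<open>R\<close> completes \<open>B\<close> to a power of \<open>c\<close>.
    Following with the image of \<open>R\<close> under \<open>\<psi>\<close> rotates exactly
    \<open>R\<close> into the prefix, which can then be dropped since it restores the
    orientation.\<close>
  have fBR: "fires dc (B @ R)" using eqc_fires[OF R fires_power_word] .
  have f: "fires dc (B @ P @ map \<psi> R)" using ends_in_w0_follow[OF g fBR] .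
  have "R \<in> lists S" using fires_lists[OF fBR] by simp
  then have RR: "map \<psi> (map \<psi> R) = R" by (induction R) (auto simp: psi_involution)
  obtain P' where P': "ends_in_w0 (B @ R) P'" using ends_in_w0_run[OF g f] unfolding RR by blast
  have "eqc ((B @ R) @ P') (power_word c N @ P')" using eqc_context[OF eqc_sym[OF R], of "[]" P'] by simp
  moreover have "fires dc ((B @ R) @ P')" using P' by (simp add: ends_in_w0_def)
  ultimately have "fires dc P'" using eqc_fires fires_power_word_append by blast
  then have "ends_in_w0 [] P'" using P' by (simp add: ends_in_w0_def)
  then show ?thesis using that[of P'] ends_in_w0_follow[of "[]" P'] by (auto simp: ends_in_w0_def)
qed

end

section \<open>Sorting words\<close>

text \<open>A normal form for firing sequences with multiplicities \<open>n\<close>: each letter is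
  used in its first \<open>n x\<close> copies of \<open>c\<close> and skipped from then on. It is
  the candidate for the sorting word.\<close>

definition layered_word :: "('a \<Rightarrow> nat) \<Rightarrow> 'a list \<Rightarrow> nat \<Rightarrow> 'a list" where
  "layered_word n c N = concat (map (\<lambda>k. filter (\<lambda>x. k < n x) c) [0..<N])"

text \<open>As the multiplicities of the two letters differ by at most one, at most one copy
  contains \<open>s\<close> alone, and nothing follows it; so alternation is kept.\<close>

lemma layered_word_pair:
  assumes "n t \<le> n s" "n s \<le> n t + 1" "s \<noteq> t"
  shows "layered_word n [s, t] N = alternating s t (min N (n s) + min N (n t))"
proof (induction N)
  case 0
  then show ?case by (simp add: layered_word_def)
next
  case (Suc N)
  have IH: "layered_word n [s, t] (Suc N) = alternating s t (min N (n s) + min N (n t)) @ filter (\<lambda>x. N < n x) [s, t]"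
    using Suc by (simp add: layered_word_def)
  consider "N < n t" | "n t = N" "n s = Suc N" | "n t \<le> N" "n s \<le> N" using assms by linarith
  then show ?case
  proof cases
    case 1
    then have "min (Suc N) (n s) + min (Suc N) (n t) = (N + N) + 2" "min N (n s) + min N (n t) = N + N"
      using assms by auto
    moreover have "filter (\<lambda>x. N < n x) [s, t] = alternating s t 2"
      using 1 assms by (simp add: numeral_2_eq_2)
    ultimately show ?thesis unfolding IH by (simp only: alternating_add) simp
  next
    case 2
    then have "min (Suc N) (n s) + min (Suc N) (n t) = (N + N) + 1" "min N (n s) + min N (n t) = N + N"
      using assms by auto
    moreover have "filter (\<lambda>x. N < n x) [s, t] = alternating s t 1"
      using 2 assms by simp
    ultimately show ?thesis unfolding IH by (simp only: alternating_add) simp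
  next
    case 3
    then have "min (Suc N) (n s) + min (Suc N) (n t) = min N (n s) + min N (n t)" using assms by auto
    then show ?thesis unfolding IH using 3 by simp
  qed
qed

lemma pr_layered_word: "pr s t (layered_word n c N) = layered_word n (pr s t c) N"
  by (simp add: layered_word_def filter_concat comp_def conj_commute)

lemma count_layered_word:
  assumes "distinct c"
  shows "count (mset (layered_word n c N)) s = (if s \<in> set c then min N (n s) else 0)"
proof (induction N)
  case 0
  then show ?case by (simp add: layered_word_def)
next
  case (Suc N)
  have "count (mset (filter (\<lambda>x. N < n x) c)) s = (if s \<in> set c \<and> N < n s then 1 else 0)"
    using distinct_count_atmost_1[of c] assms by auto
  then show ?case using Suc by (auto simp: layered_word_def)
qed

text \<open>For a position \<open>p\<close> in the periodic word, \<open>p div length c\<close> is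
  the index of the copy of \<open>c\<close> and \<open>p mod length c\<close> the place within
  it.\<close>

definition layer_positions :: "('a \<Rightarrow> nat) \<Rightarrow> 'a list \<Rightarrow> nat \<Rightarrow> nat list" where
  "layer_positions n c N =
    filter (\<lambda>p. p div length c < n (c ! (p mod length c))) [0..<length c * N]"

lemma periodic_subword_layer_positions:
  "periodic_subword c (layer_positions n c N) = layered_word n c N"
proof (induction N)
  case 0
  then show ?case by (simp add: layer_positions_def periodic_subword_def layered_word_def)
next
  case (Suc N)
  let ?L = "length c"
  let ?f = "\<lambda>p. p div ?L < n (c ! (p mod ?L))"
  have upt: "[0..<?L * Suc N] = [0..<?L * N] @ map (\<lambda>i. i + ?L * N) [0..<?L]"
    using upt_add_eq_append[of 0 "?L * N" ?L] by (simp add: map_add_upt add.commute)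
  have "(i + ?L * N) div ?L = N" if "i < ?L" for i
    using that by (subst div_mult_self2) auto
  then have "periodic_subword c (filter ?f (map (\<lambda>i. i + ?L * N) [0..<?L]))
      = map (\<lambda>i. c ! i) (filter (\<lambda>i. N < n (c ! i)) [0..<?L])"
    unfolding periodic_subword_def filter_map
    by (auto intro!: map_cong filter_cong simp: comp_def)
  also have "\<dots> = filter (\<lambda>x. N < n x) (map ((!) c) [0..<?L])"
    by (simp add: filter_map comp_def)
  also have "map ((!) c) [0..<?L] = c" by (rule map_nth)
  finally show ?case
    using Suc unfolding layer_positions_def upt
    by (simp add: layered_word_def periodic_subword_def)
qed

lemma lexord_first_difference:
  assumes "length ps = length qs" "ps \<noteq> qs"
  obtains zs p ps' q qs' where "ps = zs @ p # ps'" "qs = zs @ q # qs'" "p \<noteq> q"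
  using same_length_different[OF assms(2,1)] by auto

lemma (in coxeter_presentation) eqc_map_psi:
  assumes "eqc u v" "u \<in> lists S" shows "eqc (map \<psi> u) (map \<psi> v)"
proof -
  have "v \<in> lists S \<and> eqc (map \<psi> u) (map \<psi> v)"
  proof (rule eqc_invariant[OF assms(1)])
    fix xs ys s t
    assume *: "commuting W s t" "xs @ [s, t] @ ys \<in> lists S \<and> eqc (map \<psi> u) (map \<psi> (xs @ [s, t] @ ys))"
    then have "commuting W (\<psi> s) (\<psi> t)" using commuting_psi by simp
    then have "commutation_step W (map \<psi> xs @ [\<psi> s, \<psi> t] @ map \<psi> ys) (map \<psi> xs @ [\<psi> t, \<psi> s] @ map \<psi> ys)"
      unfolding commutation_step_def by blast
    then show "xs @ [t, s] @ ys \<in> lists S \<and> eqc (map \<psi> u) (map \<psi> (xs @ [t, s] @ ys))"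
      using *(2) unfolding equal_up_to_commutations_def
      by (auto intro: rtranclp.rtrancl_into_rtrancl)
  qed (use assms in auto)
  then show ?thesis by simp
qed

lemma (in coxeter_presentation) eqc_demazure:
  assumes "eqc u v" "u \<in> lists S" shows "demazure W S v = demazure W S u"
proof -
  have "v \<in> lists S \<and> demazure W S v = demazure W S u"
  proof (rule eqc_invariant[OF assms(1)])
    fix xs ys s t
    assume *: "commuting W s t" "xs @ [s, t] @ ys \<in> lists S \<and> demazure W S (xs @ [s, t] @ ys) = demazure W S u"
    then show "xs @ [t, s] @ ys \<in> lists S \<and> demazure W S (xs @ [t, s] @ ys) = demazure W S u"
      using demazure_commute[of xs s t ys] by simp
  qed (use assms in auto)
  then show ?thesis by simp
qed

lemma (in coxeter_presentation) intervening_neighbors_iff: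
  "intervening_neighbors W S Q \<longleftrightarrow> (\<forall>s t. nbr s t \<longrightarrow> distinct_adj (pr s t Q))"
  unfolding intervening_neighbors_def nbr_def by blast

text \<open>A word avoiding \<open>s\<close> preserves coordinate \<open>s\<close>, whereas a word
  in which \<open>s\<close> occurs once changes it from 1 to -1 on a suitable vector.\<close>

lemma (in coxeter_presentation) wp_distinct_support:
  assumes "distinct ws" "set ws = S" "cs \<in> lists S" "wp cs = wp ws"
  shows "S \<subseteq> set cs"
proof
  fix s assume s: "s \<in> S"
  then obtain X Y where XY: "ws = X @ s # Y" using assms by (metis split_list)
  have n: "s \<notin> set X" "s \<notin> set Y" using assms XY by auto
  have S: "Y \<in> lists S" "ws \<in> lists S" using assms XY by (auto simp: in_lists_conv_set)
  show "s \<in> set cs"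
  proof (rule ccontr)
    assume "s \<notin> set cs"
    define x where "x = word_action (rev Y) (simple_root s)"
    have xs: "x s = 1" unfolding x_def using n by (simp add: word_action_notin simple_root_def)
    have "word_action cs x s = 1" using \<open>s \<notin> set cs\<close> xs by (simp add: word_action_notin)
    moreover have "word_action cs x s = word_action ws x s"
      using word_action_cong[OF assms(3) S(2) assms(4)] by simp
    moreover have "word_action ws x s = -1"
      unfolding XY x_def using n s word_action_rev_cancel[OF S(1)]
      by (simp add: word_action_notin reflection_simple_root_same) (simp add: simple_root_def)
    ultimately show False by simp
  qed
qed

lemma (in coxeter_presentation) reduced_coxeter_word:
  assumes "coxeter_element W S g" "reduced_word W S cs g"
  shows "distinct cs" "set cs = S"
proof -
  obtain ws where ws: "distinct ws" "set ws = S" "wp ws = g" using assms by (auto simp: coxeter_element_def)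
  have cs: "red cs" "wp cs = g" using assms by (auto simp: reduced_word_iff)
  have csS: "cs \<in> lists S" using red_lists cs by blast
  have wsS: "ws \<in> lists S" using ws by (auto simp: in_lists_conv_set)
  have "S \<subseteq> set cs" using wp_distinct_support[OF ws(1,2) csS] cs ws by simp
  then show "set cs = S" using csS by auto
  then have "length cs \<le> card (set cs)"
    using red_le[OF cs(1) wsS] ws cs distinct_card[OF ws(1)] by simp
  then show "distinct cs" by (metis card_distinct card_length le_antisym)
qed

context coxeter_word begin

lemma c_red: "red c"
proof -
  have cS: "c \<in> lists S" using set_c by (auto simp: in_lists_conv_set)
  obtain v where v: "red v" "wp v = wp c" using red_exists cS by blast
  have "S \<subseteq> set v" using wp_distinct_support[OF distinct_c set_c red_lists[OF v(1)] v(2)] .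
  then have "card S \<le> length v" by (meson card_length card_mono finite_set le_trans)
  moreover have "length c = card S" using distinct_card[OF distinct_c] set_c by simp
  ultimately show ?thesis using v cS len_le_length[OF cS] by (simp add: red_def)
qed

lemma coxeter_element_c: "coxeter_element W S (wp c)" "reduced_word W S c (wp c)"
  using distinct_c set_c c_red by (auto simp: coxeter_element_def reduced_word_iff)

lemma fires_count:
  assumes "fires dc P" "nbr s t" "dc s t"
  shows "count (mset P) t \<le> count (mset P) s" "count (mset P) s \<le> count (mset P) t + 1"
    "count (mset P) s = count (mset P) t + length (pr s t P) mod 2"
proof -
  have a: "is_alternating s t (pr s t P)" using assms fires_iff_alternating[OF oriented_dc] by blast
  have "s \<noteq> t" using assms by (simp add: nbr_def)
  note c = count_is_alternating[OF this a, unfolded count_pr]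
  show "count (mset P) t \<le> count (mset P) s" "count (mset P) s \<le> count (mset P) t + 1"
    "count (mset P) s = count (mset P) t + length (pr s t P) mod 2"
    using c by presburger+
qed

lemma dc_nth:
  assumes "i < j" "j < length c" shows "dc (c ! i) (c ! j)"
proof -
  have c: "c = take i c @ c ! i # drop (Suc i) c" using assms by (simp add: id_take_nth_drop)
  have "c ! i \<notin> set (take i c)" "c ! j \<notin> set (take i c)"
    using assms distinct_c by (auto simp: in_set_conv_nth nth_eq_iff_index_eq)
  then have "pr (c ! i) (c ! j) (take i c) = []" by (auto simp: filter_empty_conv)
  moreover have "pr (c ! i) (c ! j) c = pr (c ! i) (c ! j) (take i c) @ pr (c ! i) (c ! j) (c ! i # drop (Suc i) c)"
    using c by (metis filter_append)
  ultimately show ?thesis by (simp add: word_orientation_def)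
qed

text \<open>The layered word with the multiplicities of \<open>P\<close> is a firing sequence, hence
  equal to \<open>P\<close> up to commutations. It remains to see that its positions are
  lexicographically first.\<close>

lemma sorting_word_eqc:
  assumes P: "fires dc P" "red P" "wp P = w0"
  shows "eqc (sorting_word W S c w0) P"
proof -
  define n where "n = count (mset P)"
  define N where "N = length P"
  let ?L = "length c"
  define ps where "ps = layer_positions n c N"
  define T where "T = layered_word n c N"
  have T: "periodic_subword c ps = T" unfolding ps_def T_def by (rule periodic_subword_layer_positions)
  have nle: "n s \<le> N" for s
    unfolding n_def N_def by (metis count_le_size size_mset)
  have n_bounds: "n t \<le> n s" "n s \<le> n t + 1" if "nbr s t" "dc s t" for s t
    unfolding n_def using fires_count[OF P(1) that] by auto
  have TS: "T \<in> lists S" unfolding T_def layered_word_def using set_c by (auto simp: in_lists_conv_set)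
  have "fires dc T" unfolding fires_iff_alternating[OF oriented_dc]
  proof (intro conjI allI impI TS)
    fix s t assume st: "nbr s t \<and> dc s t"
    then show "is_alternating s t (pr s t T)"
      using dc_pr[of s t] n_bounds[of s t] layered_word_pair[of n t s N]
      by (simp add: T_def pr_layered_word) (auto simp: nbr_def)
  qed
  moreover have "mset T = mset P"
  proof (rule multiset_eqI)
    fix s
    show "count (mset T) s = count (mset P) s"
      unfolding T_def count_layered_word[OF distinct_c] set_c using nle[of s] fires_lists[OF P(1)]
      by (auto simp: n_def[symmetric] min_def) (auto simp: n_def in_lists_conv_set)
  qed
  ultimately have eq: "eqc P T" using fires_same_mset P(1) by blast
  have rT: "red T" "wp T = w0" using eqc_red[OF eq P(2)] eqc_wp[OF eq red_lists[OF P(2)]] P by auto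
  have fdT: "full_descent T" using full_descent_iff TS rT by blast
  have sps: "sorted_wrt (<) ps" unfolding ps_def layer_positions_def
    by (intro sorted_wrt_filter) simp
  have mem: "ps \<in> sorting_positions W S c w0"
    unfolding sorting_positions_def using sps rT T by (simp add: reduced_word_iff)
  have set_ps: "p \<in> set ps \<longleftrightarrow> p < ?L * N \<and> p div ?L < n (c ! (p mod ?L))" for p
    unfolding ps_def layer_positions_def by auto
  have first: "(ps, qs) \<in> lexord less_than" if qs: "qs \<in> sorting_positions W S c w0" "qs \<noteq> ps" for qs
  proof -
    have q: "sorted_wrt (<) qs" "red (periodic_subword c qs)" "wp (periodic_subword c qs) = w0"
      using qs by (auto simp: sorting_positions_def reduced_word_iff)
    have "length ps = length qs"
    proof -
      have "length T = length (periodic_subword c qs)" using rT q by (simp add: red_def)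
      then show ?thesis using T[symmetric] by (simp add: periodic_subword_def)
    qed
    then obtain zs p ps' q' qs' where d: "ps = zs @ p # ps'" "qs = zs @ q' # qs'" "p \<noteq> q'"
      using lexord_first_difference qs(2) by metis
    \<comment> \<open>Suppose the competitor uses a position \<open>q'\<close> that
      \<open>ps\<close> skips. The letter \<open>t\<close> there will be seen to commute with the
      whole rest \<open>V\<close> of \<open>T\<close>, and is then already a descent of the common
      prefix \<open>U\<close>.\<close>
    have "p < q'"
    proof (rule ccontr)
      assume "\<not> p < q'"
      then have lt: "q' < p" using d(3) by simp
      have later: "r > q'" if "r \<in> set (p # ps')" for r
        using sps q(1) lt that unfolding d(1,2) by (auto simp: sorted_wrt_append)
      have q'ps: "q' \<notin> set ps"
        using sps q(1) lt unfolding d(1,2) by (auto simp: sorted_wrt_append)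
      have pps: "p < ?L * N" using set_ps d(1) by auto
      then have L: "?L > 0" by (cases ?L) auto
      define t where "t = c ! (q' mod ?L)"
      have qn: "n t \<le> q' div ?L" using q'ps lt pps set_ps[of q'] by (simp add: t_def)
      have t: "t \<in> S" unfolding t_def using L set_c by (metis mod_less_divisor nth_mem)
      define U V where "U = periodic_subword c zs" and "V = periodic_subword c (p # ps')"
      have UV: "T = U @ V" using T unfolding d(1) U_def V_def periodic_subword_def by simp
      have US: "U \<in> lists S" "V \<in> lists S" using TS UV by auto
      \<comment> \<open>At \<open>q'\<close> the multiplicity of \<open>t\<close> is exhausted. As
        neighbours have at most one more occurrence, a neighbour \<open>x\<close> could only follow
        in the same copy of \<open>c\<close>, which orients the edge from \<open>t\<close> to
        \<open>x\<close>; but then \<open>x\<close> has no more occurrences than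
        \<open>t\<close>.\<close>
      have V: "x \<noteq> t \<and> \<not> nbr t x" if xV: "x \<in> set V" for x
      proof -
        obtain r where r: "r \<in> set (p # ps')" "x = c ! (r mod ?L)"
          using xV unfolding V_def periodic_subword_def by auto
        have rn: "r div ?L < n x" using r d(1) set_ps[of r] by auto
        have rq: "q' < r" using later r(1) by blast
        then have rd: "q' div ?L \<le> r div ?L" by (simp add: div_le_mono)
        have "x \<noteq> t" using rn rd qn by auto
        moreover have "\<not> nbr t x"
        proof
          assume nb: "nbr t x"
          then have nb': "nbr x t" using nbr_sym by blast
          show False
          proof (cases "dc t x")
            case True
            then show False using n_bounds(1)[OF nb] rn rd qn by simp
          next
            case False
            then have dxt: "dc x t" using nb oriented_dc unfolding oriented_def by blast
            then have "r div ?L = q' div ?L" using n_bounds(2)[OF nb'] rn rd qn by simp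
            then have "q' mod ?L < r mod ?L"
              using rq by (metis div_mult_mod_eq nat_add_left_cancel_less)
            then have "dc t x" unfolding t_def r(2) using L by (intro dc_nth) auto
            then show False using False by simp
          qed
        qed
        ultimately show ?thesis by simp
      qed
      have "word_action V (simple_root t) = simple_root t"
        using V US(2) t
      proof (induction V)
        case (Cons x V)
        then have "reflection x (simple_root t) = simple_root t"
          using not_nbr_commuting commuting_sym by (intro reflection_fix_commuting) auto
        then show ?case using Cons by simp
      qed simp
      moreover have "nonpos (word_action (U @ V) (simple_root t))"
        using fdT t unfolding full_descent_def UV by blast
      \<comment> \<open>\<open>V\<close> fixes the simple root of \<open>t\<close>, so its
        negativity under \<open>U V\<close> is negativity under \<open>U\<close>; yet
        \<open>U t\<close> is a prefix of the reduced competitor.\<close>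
      ultimately have "nonpos (word_action U (simple_root t))" by simp
      moreover have "red ((U @ [t]) @ periodic_subword c qs')"
        using q(2) unfolding d(2) U_def t_def periodic_subword_def by simp
      then have "red (U @ [t])" by (rule red_append)
      ultimately show False using red_snoc root_not_both US(1) by blast
    qed
    then show ?thesis unfolding d by (auto simp: lexord_def)
  qed
  have "(THE ps. ps \<in> sorting_positions W S c w0 \<and>
        (\<forall>qs\<in>sorting_positions W S c w0. qs \<noteq> ps \<longrightarrow> (ps, qs) \<in> lexord less_than)) = ps"
  proof (rule the_equality)
    fix qs assume qs: "qs \<in> sorting_positions W S c w0 \<and>
        (\<forall>rs\<in>sorting_positions W S c w0. rs \<noteq> qs \<longrightarrow> (qs, rs) \<in> lexord less_than)"
    show "qs = ps"
    proof (rule ccontr)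
      assume "qs \<noteq> ps"
      then have "(ps, qs) \<in> lexord less_than" "(qs, ps) \<in> lexord less_than" using first qs mem by auto
      then show False by (meson asym_less_than lexord_asym asymD)
    qed
  qed (use mem first in auto)
  then have "sorting_word W S c w0 = T" by (simp add: sorting_word_def T)
  then show ?thesis using eqc_sym[OF eq] by simp
qed

text \<open>With \<open>Z\<close> equal to \<open>c^k P\<close>, the word \<open>P\<close> may be
  followed by the image of \<open>Z\<close> under \<open>\<psi>\<close>, and a preceding power of
  \<open>c\<close> does no harm. So \<open>Z\<close> followed by its image is a firing sequence, and
  neighbours alternate in it.\<close>

lemma SIN_of_sorting:
  assumes "Q \<in> lists S" "eqc Q (power_word c k @ sorting_word W S c w0)"
  shows "SIN_property W S Q"
proof -
  obtain P where P: "fires dc P" "red P" "wp P = w0" "\<And>R. fires dc R \<Longrightarrow> fires dc (P @ map \<psi> R)"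
    using w0_firing_word by blast
  define Z where "Z = power_word c k @ P"
  have QZ: "eqc Q Z"
    using eqc_trans[OF assms(2)] eqc_context[OF sorting_word_eqc[OF P(1-3)], of "power_word c k" "[]"]
    by (simp add: Z_def)
  have fZ: "fires dc Z" using P fires_power_word_append by (simp add: Z_def del: fires_append)
  have "fires dc (P @ map \<psi> Z)" using P(4)[OF fZ] .
  then have "fires dc (Z @ map \<psi> Z)"
    using fires_power_word_append[of k "P @ map \<psi> Z"] unfolding Z_def by (simp del: fires_append)
  moreover have "eqc (Z @ map \<psi> Z) (Q @ map \<psi> Q)"
    using eqc_context[OF eqc_sym[OF QZ], of "[]" "map \<psi> Z"]
      eqc_context[OF eqc_sym[OF eqc_map_psi[OF QZ assms(1)]], of Q "[]"] eqc_trans by auto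
  ultimately have f: "fires dc (Q @ map \<psi> Q)" using eqc_fires by blast
  have "intervening_neighbors W S (Q @ map \<psi> Q)"
    unfolding intervening_neighbors_iff
  proof (intro allI impI)
    fix s t assume n: "nbr s t"
    then have n': "nbr t s" "s \<noteq> t" using nbr_sym by (auto simp: nbr_def)
    have "is_alternating s t (pr s t (Q @ map \<psi> Q)) \<or> is_alternating t s (pr s t (Q @ map \<psi> Q))"
    proof (cases "dc s t")
      case True
      then show ?thesis using f n unfolding fires_iff_alternating[OF oriented_dc] by blast
    next
      case False
      then have "dc t s" using n oriented_dc unfolding oriented_def by blast
      then show ?thesis
        using f n'(1) unfolding fires_iff_alternating[OF oriented_dc] pr_sym[of s t] by blast
    qed
    then show "distinct_adj (pr s t (Q @ map \<psi> Q))" using is_alternating_distinct_adj n' by metis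
  qed
  moreover have "demazure W S Q = w0"
    using eqc_demazure[OF QZ assms(1)] demazure_w0[OF power_word_lists P(2,3), of k] by (simp add: Z_def)
  ultimately show ?thesis by (simp add: SIN_property_def)
qed

end

section \<open>From the SIN-property to powers of a Coxeter word\<close>

lemma hd_rev_remdups_rev: "hd (rev (remdups (rev xs))) = hd xs"
proof (induction xs rule: rev_induct)
  case (snoc x xs)
  then show ?case by (cases xs) auto
qed simp

lemma (in coxeter_presentation) SIN_imp_sorting:
  assumes QS: "Q \<in> lists S" and irr: "irreducible_system W S" and SIN: "SIN_property W S Q"
  shows "\<exists>g cs k. coxeter_element W S g \<and> reduced_word W S cs g \<and>
    eqc Q (power_word cs k @ sorting_word W S cs w0)"
proof -
  have inp: "distinct_adj (pr s t (Q @ map \<psi> Q))" if "nbr s t" for s t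
    using SIN that unfolding SIN_property_def intervening_neighbors_iff by blast
  obtain u where u: "red u" "wp u = w0" "set u \<subseteq> set Q" "length u \<le> length Q"
    using demazure_red[OF QS] SIN by (auto simp: SIN_property_def)
  \<comment> \<open>Every generator occurs: a word avoiding \<open>s\<close> keeps coordinate
    \<open>s\<close> of the simple root at 1, but a word for \<open>w0\<close> makes this root
    nonpositive.\<close>
  have SQ: "set Q = S"
  proof
    show "S \<subseteq> set Q"
    proof
      fix s assume s: "s \<in> S"
      show "s \<in> set Q"
      proof (rule ccontr)
        assume "s \<notin> set Q"
        then have "word_action u (simple_root s) s = 1"
          using u(3) by (subst word_action_notin) (auto simp: simple_root_def)
        moreover have "full_descent u" using full_descent_iff red_lists u by blast
        then have "nonpos (word_action u (simple_root s))" using s by (simp add: full_descent_def)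
        ultimately show False unfolding nonneg_def by (metis neg_0_le_iff_le not_one_le_zero)
      qed
    qed
  qed (use QS in auto)
  \<comment> \<open>The order of first occurrences in \<open>Q\<close>. As \<open>remdups\<close>
    keeps last occurrences, the word is reversed before and after.\<close>
  define c where "c = rev (remdups (rev Q))"
  interpret coxeter_word W S m c
    by unfold_locales (simp_all add: c_def SQ)
  have dc: "dc s t \<longleftrightarrow> hd (pr s t Q) = s" for s t
  proof -
    have "pr s t c = rev (remdups (rev (pr s t Q)))"
      by (simp add: c_def remdups_filter rev_filter)
    then show ?thesis unfolding word_orientation_def by (simp only: hd_rev_remdups_rev)
  qed
  have pr_ne: "pr s t Q \<noteq> []" "pr s t (map \<psi> Q) \<noteq> []" if "nbr s t" for s t
  proof -
    have "s \<in> set Q" "s \<in> set (map \<psi> Q)" using that SQ psi_image by (auto simp: nbr_def)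
    then show "pr s t Q \<noteq> []" "pr s t (map \<psi> Q) \<noteq> []" by (metis (mono_tags, lifting) filter_empty_conv)+
  qed
  have fQQ: "fires dc (Q @ map \<psi> Q)" unfolding fires_iff_alternating[OF oriented_dc]
  proof (intro conjI allI impI)
    show "Q @ map \<psi> Q \<in> lists S" using QS psi_in_S by (auto simp: in_lists_conv_set)
    fix s t assume n: "nbr s t \<and> dc s t"
    show "is_alternating s t (pr s t (Q @ map \<psi> Q))"
      using n dc pr_ne inp by (intro distinct_adj_is_alternating) auto
  qed
  then have fQ: "fires dc Q" by simp
  obtain P where P: "fires dc P" "red P" "wp P = w0" "\<And>R. fires dc R \<Longrightarrow> fires dc (P @ map \<psi> R)"
    using w0_firing_word by blast
  have fPQ: "fires dc (P @ map \<psi> Q)" using P(4)[OF fQ] .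
  \<comment> \<open>The excess of \<open>Q\<close> over \<open>P\<close>, to be shown constant; the
    constant is the exponent \<open>k\<close>.\<close>
  define D where "D s = int (count (mset Q) s) - int (count (mset P) s)" for s
  have D1: "D s = D t" if n: "nbr s t" "dc s t" for s t
  proof -
    \<comment> \<open>Both \<open>Q\<close> and \<open>P\<close> can be continued by the image of
      \<open>Q\<close>. The first of \<open>s\<close>, \<open>t\<close> in this continuation fixes
      the parity of the number of these letters before it, and by \<open>fires_count\<close> this
      parity is the difference of their multiplicities.\<close>
    have "even (length (pr s t X)) \<longleftrightarrow> hd (pr s t (map \<psi> Q)) = s" if "fires dc (X @ map \<psi> Q)" for X
    proof -
      have "is_alternating s t (pr s t X @ pr s t (map \<psi> Q))"
        using that n fires_iff_alternating[OF oriented_dc] by (metis filter_append)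
      moreover obtain y ys where "pr s t (map \<psi> Q) = y # ys" using pr_ne(2)[OF n(1)] by (meson list.exhaust)
      moreover have "s \<noteq> t" using n by (simp add: nbr_def)
      ultimately show ?thesis by (auto simp: is_alternating_append split: if_splits)
    qed
    from this[OF fQQ] this[OF fPQ] have "even (length (pr s t Q)) = even (length (pr s t P))" by blast
    then have "length (pr s t Q) mod 2 = length (pr s t P) mod 2" by (simp add: mod2_eq_if)
    then show ?thesis using fires_count(3)[OF fQ n] fires_count(3)[OF P(1) n] by (simp add: D_def)
  qed
  have D2: "D s = D t" if "nbr s t" for s t
  proof (cases "dc s t")
    case False
    then have "dc t s" using that oriented_dc unfolding oriented_def by blast
    then show ?thesis using D1[of t s] that nbr_sym[of s t] by simp
  qed (use D1 that in blast)
  \<comment> \<open>Otherwise a level set of \<open>D\<close> and its complement would split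
    \<open>S\<close> into two commuting parts.\<close>
  have D3: "D s = D t" if st: "s \<in> S" "t \<in> S" for s t
  proof (rule ccontr)
    assume ne: "D s \<noteq> D t"
    define J K where "J = {x \<in> S. D x = D s}" and "K = {x \<in> S. D x \<noteq> D s}"
    have "J \<noteq> {}" "K \<noteq> {}" "J \<inter> K = {}" "J \<union> K = S" using st ne by (auto simp: J_def K_def)
    moreover have "\<forall>x\<in>J. \<forall>y\<in>K. commuting W x y"
    proof (intro ballI)
      fix x y assume xy: "x \<in> J" "y \<in> K"
      then have "\<not> nbr x y" using D2[of x y] by (auto simp: J_def K_def)
      then show "commuting W x y" using xy not_nbr_commuting by (auto simp: J_def K_def)
    qed
    ultimately show False using irr unfolding irreducible_system_def by blast
  qed
  have lenP: "length P \<le> length Q" using u P red_le[OF P(2) red_lists[OF u(1)]] by simp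
  have len: "length X = (\<Sum>s\<in>S. count (mset X) s)" if "X \<in> lists S" for X
    using that finite_S by (subst size_mset[symmetric], subst size_multiset_overloaded_eq)
      (auto intro!: sum.mono_neutral_left simp: in_lists_conv_set)
  \<comment> \<open>\<open>P\<close> is a shortest word for \<open>w0\<close>, so it is no longer
    than \<open>Q\<close>; hence the sum of the equal values of \<open>D\<close> is nonnegative, and
    so is each of them. For empty \<open>S\<close> the exponent 0 will do.\<close>
  obtain k where k: "\<And>s. s \<in> S \<Longrightarrow> D s = int k"
  proof (cases "S = {}")
    case False
    then obtain s0 where s0: "s0 \<in> S" by blast
    have "int (length Q) - int (length P) = (\<Sum>s\<in>S. D s)"
      using len[OF QS] len[OF fires_lists[OF P(1)]] by (simp add: D_def sum_subtractf)
    also have "\<dots> = int (card S) * D s0" using D3[OF _ s0] by simp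
    finally have "int (card S) * D s0 \<ge> 0" using lenP by simp
    then have "D s0 \<ge> 0" using s0 finite_S by (metis card_gt_0_iff empty_iff not_le of_nat_0_less_iff mult_pos_neg)
    then show ?thesis using that[of "nat (D s0)"] D3[OF _ s0] by simp
  qed (use that[of 0] in auto)
  have "mset Q = mset (power_word c k @ P)"
  proof (rule multiset_eqI)
    fix s
    show "count (mset Q) s = count (mset (power_word c k @ P)) s"
    proof (cases "s \<in> S")
      case True
      then show ?thesis using k[OF True] count_power_word[of k s] by (simp add: D_def)
    next
      case False
      then have "s \<notin> set Q" "s \<notin> set P" using QS fires_lists[OF P(1)] by auto
      then show ?thesis using False count_power_word[of k s] by (simp add: count_mset_0_iff[THEN iffD2])
    qed
  qed
  then have "eqc Q (power_word c k @ P)"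
    using fires_same_mset[OF _ fQ] P(1) fires_power_word_append by simp
  then have "eqc Q (power_word c k @ sorting_word W S c w0)"
    using eqc_trans eqc_context[OF eqc_sym[OF sorting_word_eqc[OF P(1-3)]], of "power_word c k" "[]"] by auto
  then show ?thesis using coxeter_element_c by blast
qed

theorem theorem2p7:
  fixes W :: "('a, 'b) monoid_scheme" and S :: "'a set" and Q :: "'a list"
  assumes "coxeter_system W S"
    and "finite (carrier W)"
    and "Q \<in> lists S"
  shows "(irreducible_system W S \<longrightarrow>
           (SIN_property W S Q \<longleftrightarrow>
             (\<exists>c cs k. coxeter_element W S c \<and> reduced_word W S cs c \<and>
                equal_up_to_commutations W Q
                  (concat (replicate k cs) @ sorting_word W S cs (longest_element W S))))) \<and>
         (\<forall>c cs k. coxeter_element W S c \<and> reduced_word W S cs c \<and>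
            equal_up_to_commutations W Q
              (concat (replicate k cs) @ sorting_word W S cs (longest_element W S)) \<longrightarrow>
            SIN_property W S Q)"
proof -
  obtain m where m: "coxeter_matrix S m" "\<forall>u\<in>lists S. \<forall>v\<in>lists S.
      word_prod W u = word_prod W v \<longleftrightarrow> equivclp (delete_relator S m) u v"
    using assms(1) unfolding coxeter_system_def by blast
  interpret coxeter_presentation W S m
    using assms m unfolding coxeter_presentation_def coxeter_presentation_axioms_def coxeter_system_def by blast
  have "SIN_property W S Q"
    if c: "coxeter_element W S c" "reduced_word W S cs c"
      and e: "eqc Q (power_word cs k @ sorting_word W S cs w0)" for c cs k
  proof -
    \<comment> \<open>A reduced word of a Coxeter element contains each generator exactly
      once.\<close>
    interpret coxeter_word W S m cs
      using reduced_coxeter_word[OF c] by unfold_locales auto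
    show ?thesis using SIN_of_sorting[OF assms(3) e] .
  qed
  then show ?thesis using SIN_imp_sorting[OF assms(3)] by blast
qed

end
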